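(* Let $G$ be a normed group and $X$ a metric space, and suppose (i) $G$ has a separately continuous and transitive Nikodym action $\varphi$ on $X$, and (ii) $G$ is a Baire space under its norm topology and $X$ is non-meagre (in itself). Then for every open neighbourhood $U$ of $e_G$ and every $x\in X$, the set $Ux=\{u(x):u\in U\}$ is a neighbourhood of $x$; in particular each point-evaluation map $\varphi_x:g\mapsto g(x)$ is open, i.e. the action is micro-transitive. Moreover, the same conclusion holds if, in place of the Nikodym property of the action, one assumes that $G$ is analytic and Baire and all point-evaluation maps $\varphi_x$ are base-$\sigma$-discrete.
   Context: All spaces are metrizable. A normed group is a group $G$ with a group-norm $\|\cdot\|:G\to\mathbb R_+$ satisfying $\|st\|\le\|s\|+\|t\|$, $\|t\|>0$ for $t\ne e_G$, $\|e_G\|=0$, and $\|t^{-1}\|=\|t\|$; its (right) norm topology is that of the right-invariant metric $d_R(s,t)=\|st^{-1}\|$. A group action $\varphi:G\times X\to X$ satisfies $\varphi(e_G,x)=x$, $\varphi(gh,x)=\varphi(g,\varphi(h,x))$; write $g(x)=gx=\varphi(g,x)$. It is separately continuous if $x\mapsto\varphi(g,x)$ is continuous for each $g$ and $\varphi_x:g\mapsto\varphi(g,x)$ is continuous for each $x$; transitive if for all $x,y$ there is $g$ with $g(x)=y$. The action is a Nikodym action if for every non-empty open neighbourhood $U$ of $e_G$ and every $x\in X$, $Ux$ contains a non-meagre set with the Baire property. The action is micro-transitive if $Ax$ is a neighbourhood of $x$ for every $x$ and every neighbourhood $A$ of $e_G$. A metrizable space is analytic if it embeds in its metric completion as a Souslin-$\mathcal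 F$ set $\bigcup_{i\in\mathbb N^{\mathbb N}}\bigcap_n H(i|n)$ with $H(i|n)$ closed. A family is discrete if every point has a neighbourhood meeting at most one member; $\sigma$-discrete if a countable union of discrete families; $\mathcal B$ is a base for $\mathcal A$ if every member of $\mathcal A$ is a union of members of $\mathcal B$. A map $f:X\to Y$ is base-$\sigma$-discrete if the image $\{f(E):E\in\mathcal E\}$ of any discrete family $\mathcal E$ in $X$ has a $\sigma$-discrete base in $Y$. *)

theory Defs
  imports "HOL-Analysis.Analysis"
begin

definition group_norm :: "('g::group_add \<Rightarrow> real) \<Rightarrow> bool" where
  "group_norm nm \<longleftrightarrow>
     (\<forall>s t. nm (s + t) \<le> nm s + nm t) \<and> (\<forall>t. t \<noteq> 0 \<longrightarrow> nm t > 0) \<and>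
     nm 0 = 0 \<and> (\<forall>t. nm (- t) = nm t)"

text \<open>right-invariant metric d_R(s,t) = norm of s t^-1 (here s - t = s + - t)\<close>
definition dR :: "('g::group_add \<Rightarrow> real) \<Rightarrow> 'g \<Rightarrow> 'g \<Rightarrow> real" where
  "dR nm s t = nm (s - t)"

definition norm_topology :: "('g::group_add \<Rightarrow> real) \<Rightarrow> 'g topology" where
  "norm_topology nm = Metric_space.mtopology UNIV (dR nm)"

definition nowhere_dense_in :: "'a topology \<Rightarrow> 'a set \<Rightarrow> bool" where
  "nowhere_dense_in T S \<longleftrightarrow> S \<subseteq> topspace T \<and> T interior_of (T closure_of S) = {}"

definition meagre_in :: "'a topology \<Rightarrow> 'a set \<Rightarrow> bool" where
  "meagre_in T S \<longleftrightarrow> (\<exists>N :: nat \<Rightarrow> 'a set. (\<forall>n. nowhere_dense_in T (N n)) \<and> S = \<Union>(range N))"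

definition baire_property_in :: "'a topology \<Rightarrow> 'a set \<Rightarrow> bool" where
  "baire_property_in T A \<longleftrightarrow> A \<subseteq> topspace T \<and>
     (\<exists>U. openin T U \<and> meagre_in T ((A - U) \<union> (U - A)))"

definition Baire_space_top :: "'a topology \<Rightarrow> bool" where
  "Baire_space_top T \<longleftrightarrow> (\<forall>U. openin T U \<and> U \<noteq> {} \<longrightarrow> \<not> meagre_in T U)"

definition group_action :: "('g::group_add \<Rightarrow> 'x \<Rightarrow> 'x) \<Rightarrow> bool" where
  "group_action \<phi> \<longleftrightarrow> (\<forall>x. \<phi> 0 x = x) \<and> (\<forall>g h x. \<phi> (g + h) x = \<phi> g (\<phi> h x))"

definition separately_continuous ::
  "'g topology \<Rightarrow> ('g \<Rightarrow> 'x::topological_space \<Rightarrow> 'x) \<Rightarrow> bool" where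
  "separately_continuous TG \<phi> \<longleftrightarrow>
     (\<forall>g. continuous_on UNIV (\<phi> g)) \<and> (\<forall>x. continuous_map TG euclidean (\<lambda>g. \<phi> g x))"

definition transitive_action :: "('g \<Rightarrow> 'x \<Rightarrow> 'x) \<Rightarrow> bool" where
  "transitive_action \<phi> \<longleftrightarrow> (\<forall>x y. \<exists>g. \<phi> g x = y)"

definition nikodym_action ::
  "'g::group_add topology \<Rightarrow> ('g \<Rightarrow> 'x::topological_space \<Rightarrow> 'x) \<Rightarrow> bool" where
  "nikodym_action TG \<phi> \<longleftrightarrow>
     (\<forall>U x. openin TG U \<and> U \<noteq> {} \<and> 0 \<in> U \<longrightarrow>
        (\<exists>A. A \<subseteq> (\<lambda>u. \<phi> u x) ` U \<and> \<not> meagre_in euclidean A \<and> baire_property_in euclidean A))"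

definition micro_transitive ::
  "'g::group_add topology \<Rightarrow> ('g \<Rightarrow> 'x::topological_space \<Rightarrow> 'x) \<Rightarrow> bool" where
  "micro_transitive TG \<phi> \<longleftrightarrow>
     (\<forall>x A. (\<exists>V. openin TG V \<and> 0 \<in> V \<and> V \<subseteq> A) \<longrightarrow>
        x \<in> interior ((\<lambda>a. \<phi> a x) ` A))"

definition souslin_F :: "'a topology \<Rightarrow> 'a set \<Rightarrow> bool" where
  "souslin_F T S \<longleftrightarrow> (\<exists>H :: nat list \<Rightarrow> 'a set. (\<forall>s. closedin T (H s)) \<and>
      S = (\<Union>i::nat \<Rightarrow> nat. \<Inter>n. H (map i [0..<Suc n])))"

text \<open>A metric space (M,d) is analytic if its image under an isometric embedding into a
  complete metric space (equivalently: into its completion) is Souslin-F.  The carrier type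
  'c of the complete space is a parameter; a free type variable in an assumption is
  universally quantified at theorem level, so this expresses an existential.\<close>
definition analytic_via :: "'c itself \<Rightarrow> 'a set \<Rightarrow> ('a \<Rightarrow> 'a \<Rightarrow> real) \<Rightarrow> bool" where
  "analytic_via _ M d \<longleftrightarrow>
     (\<exists>(Y::'c set) dY f. Metric_space Y dY \<and> Metric_space.mcomplete Y dY \<and>
        f ` M \<subseteq> Y \<and> (\<forall>x\<in>M. \<forall>y\<in>M. dY (f x) (f y) = d x y) \<and>
        souslin_F (Metric_space.mtopology Y dY) (f ` M))"

definition discrete_family :: "'a topology \<Rightarrow> 'a set set \<Rightarrow> bool" where
  "discrete_family T \<E> \<longleftrightarrow>
     (\<forall>x\<in>topspace T. \<exists>V. openin T V \<and> x \<in> V \<and>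
        (\<forall>E1\<in>\<E>. \<forall>E2\<in>\<E>. E1 \<inter> V \<noteq> {} \<and> E2 \<inter> V \<noteq> {} \<longrightarrow> E1 = E2))"

definition sigma_discrete :: "'a topology \<Rightarrow> 'a set set \<Rightarrow> bool" where
  "sigma_discrete T \<B> \<longleftrightarrow>
     (\<exists>F :: nat \<Rightarrow> 'a set set. \<B> = \<Union>(range F) \<and> (\<forall>n. discrete_family T (F n)))"

definition base_for :: "'a set set \<Rightarrow> 'a set set \<Rightarrow> bool" where
  "base_for \<B> \<A> \<longleftrightarrow> (\<forall>A\<in>\<A>. \<exists>\<C>\<subseteq>\<B>. A = \<Union>\<C>)"

definition base_sigma_discrete :: "'a topology \<Rightarrow> 'b topology \<Rightarrow> ('a \<Rightarrow> 'b) \<Rightarrow> bool" where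
  "base_sigma_discrete TX TY f \<longleftrightarrow>
     (\<forall>\<E>. discrete_family TX \<E> \<longrightarrow>
        (\<exists>\<B>. sigma_discrete TY \<B> \<and> base_for \<B> ((\<lambda>E. f ` E) ` \<E>)))"

end

theory Submission
  imports Defs
begin

text \<open>If the orbits \<open>Ux\<close> of all small balls are non-meagre and comeagre in some non-empty open set, the
  action is micro-transitive; a Nikodym action satisfies this at once. In the analytic case, the
  sets \<open>E\<close> with \<open>Ex\<close> meagre form an ideal closed under discrete unions, so a Souslin scheme can be
  followed by a tree of disjoint open sets, and non-meagre orbits of balls are comeagre somewhere. Transitivity
  and \<open>X\<close> non-meagre give one point at which all small balls have non-meagre orbits. To carry this
  to another point by \<open>f\<close>, conjugation by \<open>f\<close> must be continuous at the identity modulo the kernel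
  of the action. A category argument in \<open>G\<close>, where right translations are homeomorphisms, gives this
  unless some point is thin, meaning that the orbit of a small ball meets every compact set in a
  countable set. Cantor sets of group elements exclude thin points: first for points fixed by a ball,
  by a definable form of Sierpinski's argument on the square of a Cantor set, and then in
  general.\<close>

section \<open>Baire category\<close>

text \<open>\<open>G\<close> need not be separable, so countable covers by small balls are replaced
  by sigma-discrete ones, and every notion of smallness must survive discrete unions. Only right
  translations are known to be continuous; left translations, inversion and conjugation are not. Yet
  \<open>\<phi> f\<close> carries the orbit of a ball at \<open>y\<close> to points
  \<open>\<phi> (f + b) y\<close>, while a ball orbit at \<open>\<phi> f y\<close> consists of
  points \<open>\<phi> (a + f) y\<close>. A discrete family in \<open>G\<close> cannot be pulled
  back along left translation by \<open>f\<close>. It is pushed to \<open>X\<close> by evaluation at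
  a point \<open>z\<close> and pulled back along the continuous map sending \<open>g\<close> to
  \<open>\<phi> (f + g) z\<close>. This confuses members with a common image point, so only
  countably many of them may meet at one point; thinness marks the points where that count could
  fail. Points fixed by a ball are excluded first, since then the fibres of the evaluations are
  meagre in \<open>G\<close>, as the Cantor set for a general thin point requires.\<close>

lemma nowhere_dense_in_iff:
  "nowhere_dense_in T S \<longleftrightarrow> S \<subseteq> topspace T \<and>
     (\<forall>U. openin T U \<and> U \<noteq> {} \<longrightarrow> (\<exists>W. openin T W \<and> W \<noteq> {} \<and> W \<subseteq> U \<and> W \<inter> S = {}))"
proof (intro iffI conjI allI impI)
  assume nd: "nowhere_dense_in T S"
  then show "S \<subseteq> topspace T" by (simp add: nowhere_dense_in_def)
  fix U assume U: "openin T U \<and> U \<noteq> {}"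
  let ?W = "U - T closure_of S"
  have op: "openin T ?W" using U by (simp add: openin_diff)
  have "?W \<noteq> {}"
  proof
    assume "?W = {}"
    then have "U \<subseteq> T interior_of (T closure_of S)"
      using U by (simp add: interior_of_maximal)
    then show False using nd U by (auto simp: nowhere_dense_in_def)
  qed
  moreover have "?W \<inter> S = {}"
    using closure_of_subset[of S T] \<open>S \<subseteq> topspace T\<close> by blast
  ultimately show "\<exists>W. openin T W \<and> W \<noteq> {} \<and> W \<subseteq> U \<and> W \<inter> S = {}"
    using op by blast
next
  assume r: "S \<subseteq> topspace T \<and>
     (\<forall>U. openin T U \<and> U \<noteq> {} \<longrightarrow> (\<exists>W. openin T W \<and> W \<noteq> {} \<and> W \<subseteq> U \<and> W \<inter> S = {}))"
  have "T interior_of (T closure_of S) = {}"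
  proof (rule ccontr)
    assume "T interior_of (T closure_of S) \<noteq> {}"
    then obtain W where W: "openin T W" "W \<noteq> {}" "W \<subseteq> T interior_of (T closure_of S)" "W \<inter> S = {}"
      using r openin_interior_of[of T "T closure_of S"] by blast
    have "W \<inter> T closure_of S = {}"
      using W by (simp add: openin_Int_closure_of_eq_empty)
    then show False using W interior_of_subset[of T "T closure_of S"] by blast
  qed
  then show "nowhere_dense_in T S" using r by (simp add: nowhere_dense_in_def)
qed

lemma nowhere_dense_in_subset:
  "nowhere_dense_in T S \<Longrightarrow> R \<subseteq> S \<Longrightarrow> nowhere_dense_in T R"
  unfolding nowhere_dense_in_def
  using closure_of_mono[of R S T] interior_of_mono[of "T closure_of R" "T closure_of S" T] by auto

lemma nowhere_dense_in_empty: "nowhere_dense_in T {}"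
  by (auto simp: nowhere_dense_in_iff)

lemma meagre_in_iff:
  "meagre_in T S \<longleftrightarrow> (\<exists>N :: nat \<Rightarrow> 'a set. (\<forall>n. nowhere_dense_in T (N n)) \<and> S \<subseteq> (\<Union>n. N n))"
proof
  assume "\<exists>N :: nat \<Rightarrow> 'a set. (\<forall>n. nowhere_dense_in T (N n)) \<and> S \<subseteq> (\<Union>n. N n)"
  then obtain N :: "nat \<Rightarrow> 'a set"
    where N: "\<And>n. nowhere_dense_in T (N n)" "S \<subseteq> (\<Union>n. N n)" by blast
  have "\<forall>n. nowhere_dense_in T (S \<inter> N n)" using N(1) nowhere_dense_in_subset by blast
  moreover have "S = \<Union>(range (\<lambda>n. S \<inter> N n))" using N(2) by blast
  ultimately show "meagre_in T S"
    unfolding meagre_in_def by (intro exI[of _ "\<lambda>n. S \<inter> N n"] conjI)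
qed (auto simp: meagre_in_def)

lemma meagre_in_subset:
  assumes "meagre_in T S" "R \<subseteq> S"
  shows "meagre_in T R"
proof -
  obtain N where "\<And>n::nat. nowhere_dense_in T (N n)" "S \<subseteq> (\<Union>n. N n)"
    using assms(1) by (auto simp: meagre_in_iff)
  then show ?thesis
    unfolding meagre_in_iff using assms(2) by (intro exI[of _ N]) auto
qed

lemma nowhere_dense_imp_meagre: "nowhere_dense_in T S \<Longrightarrow> meagre_in T S"
  unfolding meagre_in_iff by (intro exI[of _ "\<lambda>_. S"]) simp

lemma meagre_in_empty: "meagre_in T {}"
  by (simp add: nowhere_dense_imp_meagre nowhere_dense_in_empty)

lemma meagre_in_UN:
  fixes F :: "'i \<Rightarrow> 'a set"
  assumes "countable I" and m: "\<And>i. i \<in> I \<Longrightarrow> meagre_in T (F i)"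
  shows "meagre_in T (\<Union>i\<in>I. F i)"
proof (cases "I = {}")
  case False
  have "\<forall>i\<in>I. \<exists>N :: nat \<Rightarrow> _. (\<forall>n. nowhere_dense_in T (N n)) \<and> F i \<subseteq> (\<Union>n. N n)"
    using m meagre_in_iff by blast
  then obtain N where N: "\<And>i n. i \<in> I \<Longrightarrow> nowhere_dense_in T (N i (n::nat))"
      "\<And>i. i \<in> I \<Longrightarrow> F i \<subseteq> (\<Union>n. N i n)"
    by metis
  obtain q :: "nat \<Rightarrow> 'i" where q: "range q = I"
    using assms(1) False by (metis range_from_nat_into)
  define P where "P k = N (q (fst (prod_decode k))) (snd (prod_decode k))" for k
  have "\<forall>k. nowhere_dense_in T (P k)" using N(1) q by (auto simp: P_def)
  moreover have "(\<Union>i\<in>I. F i) \<subseteq> (\<Union>k. P k)"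
  proof
    fix x assume "x \<in> (\<Union>i\<in>I. F i)"
    then obtain i where "i \<in> I" "x \<in> F i" by blast
    then obtain n where "x \<in> N i n" using N(2) by blast
    obtain j where "q j = i" using q \<open>i \<in> I\<close> by auto
    then have "x \<in> P (prod_encode (j, n))" using \<open>x \<in> N i n\<close> by (simp add: P_def)
    then show "x \<in> (\<Union>k. P k)" by blast
  qed
  ultimately show ?thesis unfolding meagre_in_iff by (intro exI[of _ P] conjI)
qed (simp add: meagre_in_empty)

lemma meagre_in_Un: "meagre_in T A \<Longrightarrow> meagre_in T B \<Longrightarrow> meagre_in T (A \<union> B)"
  using meagre_in_UN[of "{A, B}" T "\<lambda>x. x"] by auto

lemma meagre_in_homeomorphic_image:
  assumes h: "homeomorphic_map T T' h" and m: "meagre_in T S"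
  shows "meagre_in T' (h ` S)"
proof -
  have nd: "nowhere_dense_in T' (h ` N)" if "nowhere_dense_in T N" for N
  proof -
    have N: "N \<subseteq> topspace T" using that by (simp add: nowhere_dense_in_def)
    have "T' closure_of (h ` N) = h ` (T closure_of N)"
      by (rule homeomorphic_map_closure_of[OF h N])
    moreover have "T' interior_of (h ` (T closure_of N)) = h ` (T interior_of (T closure_of N))"
      by (rule homeomorphic_map_interior_of[OF h closure_of_subset_topspace])
    moreover have "h ` N \<subseteq> topspace T'"
      using N homeomorphic_imp_surjective_map[OF h] by blast
    ultimately show ?thesis using that by (simp add: nowhere_dense_in_def)
  qed
  obtain N where N: "\<And>n::nat. nowhere_dense_in T (N n)" "S \<subseteq> (\<Union>n. N n)"
    using m by (auto simp: meagre_in_iff)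
  have "h ` S \<subseteq> (\<Union>n. h ` N n)" using N(2) by blast
  then show ?thesis
    unfolding meagre_in_iff using N(1) nd by (intro exI[of _ "\<lambda>n. h ` N n"]) simp
qed

text \<open>Split every member into nowhere dense pieces. The pieces of index \<open>n\<close> from
  all members together stay nowhere dense, because an open set can be shrunk until it sees at most
  one member; so the family may be uncountable. Isolating sets \<open>V\<close> are required inside
  every open set, not around every point: disjoint open sets, as in \<open>Banach_category\<close>,
  need not be discrete at their boundaries.\<close>

lemma meagre_in_UN_local:
  assumes sub: "\<And>D. D \<in> \<D> \<Longrightarrow> meagre_in T D"
    and loc: "\<And>U. openin T U \<Longrightarrow> U \<noteq> {} \<Longrightarrow>
      \<exists>V. openin T V \<and> V \<noteq> {} \<and> V \<subseteq> U \<and>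
        (\<forall>D1\<in>\<D>. \<forall>D2\<in>\<D>. D1 \<inter> V \<noteq> {} \<and> D2 \<inter> V \<noteq> {} \<longrightarrow> D1 = D2)"
  shows "meagre_in T (\<Union>\<D>)"
proof -
  have "\<forall>D\<in>\<D>. \<exists>N :: nat \<Rightarrow> _. (\<forall>n. nowhere_dense_in T (N n)) \<and> D = (\<Union>n. N n)"
    using sub by (auto simp: meagre_in_def)
  then obtain N where N: "\<And>D n. D \<in> \<D> \<Longrightarrow> nowhere_dense_in T (N D (n::nat))"
      "\<And>D. D \<in> \<D> \<Longrightarrow> D = (\<Union>n. N D n)"
    by metis
  have ND: "N D n \<subseteq> D" if "D \<in> \<D>" for D n
    by (subst N(2)[OF that]) blast
  have "nowhere_dense_in T (\<Union>D\<in>\<D>. N D n)" for n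
    unfolding nowhere_dense_in_iff
  proof (intro conjI allI impI)
    show "(\<Union>D\<in>\<D>. N D n) \<subseteq> topspace T"
      using N(1) by (auto simp: nowhere_dense_in_def)
    fix U assume U: "openin T U \<and> U \<noteq> {}"
    then obtain V where V: "openin T V" "V \<noteq> {}" "V \<subseteq> U"
      "\<forall>D1\<in>\<D>. \<forall>D2\<in>\<D>. D1 \<inter> V \<noteq> {} \<and> D2 \<inter> V \<noteq> {} \<longrightarrow> D1 = D2"
      using loc[of U] by metis
    show "\<exists>W. openin T W \<and> W \<noteq> {} \<and> W \<subseteq> U \<and> W \<inter> (\<Union>D\<in>\<D>. N D n) = {}"
    proof (cases "\<exists>D\<in>\<D>. D \<inter> V \<noteq> {}")
      case True
      then obtain D where D: "D \<in> \<D>" "D \<inter> V \<noteq> {}" by blast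
      have "\<forall>U. openin T U \<and> U \<noteq> {} \<longrightarrow>
          (\<exists>W. openin T W \<and> W \<noteq> {} \<and> W \<subseteq> U \<and> W \<inter> N D n = {})"
        using N(1)[OF D(1), of n] by (simp add: nowhere_dense_in_iff)
      from mp[OF spec[OF this, of V] conjI[OF V(1,2)]]
      obtain W where W: "openin T W" "W \<noteq> {}" "W \<subseteq> V" "W \<inter> N D n = {}"
        by (elim exE conjE)
      have "W \<inter> N D' n = {}" if D': "D' \<in> \<D>" for D'
      proof (cases "D' = D")
        case False
        then have "D' \<inter> V = {}" using V(4) D D' by metis
        then show ?thesis using W(3) ND[OF D', of n] by auto
      qed (use W(4) in simp)
      then have "W \<inter> (\<Union>D\<in>\<D>. N D n) = {}" by auto
      then show ?thesis using W(1-3) V(3) by (intro exI[of _ W]) auto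
    next
      case False
      then have "V \<inter> (\<Union>D\<in>\<D>. N D n) = {}" using ND by blast
      then show ?thesis using V(1-3) by (intro exI[of _ V]) auto
    qed
  qed
  moreover have "\<Union>\<D> \<subseteq> (\<Union>n. \<Union>D\<in>\<D>. N D n)"
  proof
    fix x assume "x \<in> \<Union>\<D>"
    then obtain D where "D \<in> \<D>" "x \<in> D" by blast
    then have "x \<in> (\<Union>n. N D n)" using N(2) by metis
    then show "x \<in> (\<Union>n. \<Union>D\<in>\<D>. N D n)" using \<open>D \<in> \<D>\<close> by blast
  qed
  ultimately show ?thesis
    unfolding meagre_in_iff by (intro exI[of _ "\<lambda>n. \<Union>D\<in>\<D>. N D n"]) simp
qed

section \<open>Discrete unions and the Banach category theorem\<close>

lemma discrete_family_subsets:
  assumes "discrete_family T \<E>" and "\<And>E. E \<in> \<E> \<Longrightarrow> f E \<subseteq> E"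
  shows "discrete_family T (f ` \<E>)"
  unfolding discrete_family_def
proof
  fix x assume "x \<in> topspace T"
  then obtain V where "openin T V" "x \<in> V"
    "\<forall>E1\<in>\<E>. \<forall>E2\<in>\<E>. E1 \<inter> V \<noteq> {} \<and> E2 \<inter> V \<noteq> {} \<longrightarrow> E1 = E2"
    using assms(1) by (auto simp: discrete_family_def)
  then have "\<forall>E1\<in>f ` \<E>. \<forall>E2\<in>f ` \<E>. E1 \<inter> V \<noteq> {} \<and> E2 \<inter> V \<noteq> {} \<longrightarrow> E1 = E2"
    using assms(2) by blast
  then show "\<exists>V. openin T V \<and> x \<in> V \<and>
      (\<forall>E1\<in>f ` \<E>. \<forall>E2\<in>f ` \<E>. E1 \<inter> V \<noteq> {} \<and> E2 \<inter> V \<noteq> {} \<longrightarrow> E1 = E2)"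
    using \<open>openin T V\<close> \<open>x \<in> V\<close> by blast
qed

lemma discrete_family_mono: "discrete_family T \<E> \<Longrightarrow> \<F> \<subseteq> \<E> \<Longrightarrow> discrete_family T \<F>"
  unfolding discrete_family_def by (meson in_mono)

lemma meagre_in_discrete_Union:
  assumes "discrete_family T \<D>" and "\<And>D. D \<in> \<D> \<Longrightarrow> meagre_in T D"
  shows "meagre_in T (\<Union>\<D>)"
proof (rule meagre_in_UN_local[OF assms(2)])
  fix U assume U: "openin T U" "U \<noteq> {}"
  then obtain x where "x \<in> U" "x \<in> topspace T" using openin_subset by blast
  then obtain V where V: "openin T V" "x \<in> V"
    "\<forall>E1\<in>\<D>. \<forall>E2\<in>\<D>. E1 \<inter> V \<noteq> {} \<and> E2 \<inter> V \<noteq> {} \<longrightarrow> E1 = E2"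
    using assms(1) by (auto simp: discrete_family_def)
  show "\<exists>V. openin T V \<and> V \<noteq> {} \<and> V \<subseteq> U \<and>
        (\<forall>D1\<in>\<D>. \<forall>D2\<in>\<D>. D1 \<inter> V \<noteq> {} \<and> D2 \<inter> V \<noteq> {} \<longrightarrow> D1 = D2)"
    using U V \<open>x \<in> U\<close> by (intro exI[of _ "U \<inter> V"]) auto
qed

text \<open>Zorn's lemma. Maximality makes the union of the family dense in \<open>G0\<close>: an
  open subset missed by every member would contain a new member by \<open>step\<close>. Such
  families also form the levels of the tree in \<open>comeagre_limits\<close>.\<close>

lemma maximal_disjoint_open:
  assumes step: "\<And>U. openin T U \<Longrightarrow> U \<noteq> {} \<Longrightarrow> U \<subseteq> G0 \<Longrightarrow>
      \<exists>W. openin T W \<and> W \<noteq> {} \<and> W \<subseteq> U \<and> Q W"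
  shows "\<exists>\<M>. (\<forall>W\<in>\<M>. openin T W \<and> W \<noteq> {} \<and> W \<subseteq> G0 \<and> Q W) \<and> disjoint \<M> \<and>
      (\<forall>U. openin T U \<and> U \<noteq> {} \<and> U \<subseteq> G0 \<longrightarrow> (\<exists>W\<in>\<M>. W \<inter> U \<noteq> {}))"
proof -
  define P where "P W \<longleftrightarrow> openin T W \<and> W \<noteq> {} \<and> W \<subseteq> G0 \<and> Q W" for W
  define \<A> where "\<A> = {\<M>. (\<forall>W\<in>\<M>. P W) \<and> disjoint \<M>}"
  have "\<exists>\<M>\<in>\<A>. \<forall>\<X>\<in>\<A>. \<M> \<subseteq> \<X> \<longrightarrow> \<X> = \<M>"
  proof (rule subset_Zorn_nonempty)
    show "\<A> \<noteq> {}" by (auto simp: \<A>_def intro!: exI[of _ "{}"])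
    fix \<C> assume C: "\<C> \<noteq> {}" "subset.chain \<A> \<C>"
    have "disjoint (\<Union>\<C>)"
      unfolding pairwise_def
    proof (intro ballI impI)
      fix x y assume xy: "x \<in> \<Union>\<C>" "y \<in> \<Union>\<C>" "x \<noteq> y"
      then obtain a b where ab: "a \<in> \<C>" "x \<in> a" "b \<in> \<C>" "y \<in> b" by blast
      then have "a \<subseteq> b \<or> b \<subseteq> a" using C(2) by (auto simp: subset.chain_def)
      then obtain c where "c \<in> \<C>" "x \<in> c" "y \<in> c" using ab by blast
      moreover have "disjoint c" using \<open>c \<in> \<C>\<close> C(2) by (auto simp: subset.chain_def \<A>_def)
      ultimately show "disjnt x y" using xy by (auto simp: pairwise_def)
    qed
    then show "\<Union>\<C> \<in> \<A>" using C(2) by (auto simp: subset.chain_def \<A>_def)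
  qed
  then obtain \<M> where M: "\<M> \<in> \<A>" "\<And>\<X>. \<X> \<in> \<A> \<Longrightarrow> \<M> \<subseteq> \<X> \<Longrightarrow> \<X> = \<M>" by blast
  have "\<exists>W\<in>\<M>. W \<inter> U \<noteq> {}" if U: "openin T U" "U \<noteq> {}" "U \<subseteq> G0" for U
  proof (rule ccontr)
    assume no: "\<not> (\<exists>W\<in>\<M>. W \<inter> U \<noteq> {})"
    obtain W where W: "openin T W" "W \<noteq> {}" "W \<subseteq> U" "Q W" using step[OF U] by blast
    have "\<forall>W'\<in>\<M>. disjnt W W' \<and> disjnt W' W" using no W(3) by (auto simp: disjnt_def)
    then have "disjoint (insert W \<M>)"
      using M(1) by (simp add: \<A>_def pairwise_insert)
    then have "insert W \<M> \<in> \<A>" using M(1) W U by (auto simp: \<A>_def P_def)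
    then have "W \<in> \<M>" using M(2) by blast
    then show False using no W by blast
  qed
  then show ?thesis using M(1) unfolding \<A>_def P_def by blast
qed

text \<open>A maximal disjoint family of good open sets leaves only a nowhere dense remainder, and
  inside one member no other member is visible, so the meagre traces add up to a meagre set.\<close>

lemma Banach_category:
  assumes A: "A \<subseteq> topspace T"
    and loc: "\<And>U. openin T U \<Longrightarrow> U \<noteq> {} \<Longrightarrow>
      \<exists>W. openin T W \<and> W \<noteq> {} \<and> W \<subseteq> U \<and> meagre_in T (A \<inter> W)"
  shows "meagre_in T A"
proof -
  have "\<exists>\<M>. (\<forall>W\<in>\<M>. openin T W \<and> W \<noteq> {} \<and> W \<subseteq> UNIV \<and> meagre_in T (A \<inter> W)) \<and>
      disjoint \<M> \<and> (\<forall>U. openin T U \<and> U \<noteq> {} \<and> U \<subseteq> UNIV \<longrightarrow> (\<exists>W\<in>\<M>. W \<inter> U \<noteq> {}))"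
    by (rule maximal_disjoint_open) (rule loc)
  then obtain \<M> where M: "\<And>W. W \<in> \<M> \<Longrightarrow> openin T W \<and> W \<noteq> {} \<and> meagre_in T (A \<inter> W)"
    "disjoint \<M>" "\<And>U. openin T U \<Longrightarrow> U \<noteq> {} \<Longrightarrow> \<exists>W\<in>\<M>. W \<inter> U \<noteq> {}"
    by (metis subset_UNIV)
  have "meagre_in T (\<Union>((\<lambda>W. A \<inter> W) ` \<M>))"
  proof (rule meagre_in_UN_local)
    fix U assume U: "openin T U" "U \<noteq> {}"
    then obtain W where W: "W \<in> \<M>" "W \<inter> U \<noteq> {}" using M(3) by blast
    have *: "W' = W" if "W' \<in> \<M>" "W' \<inter> (W \<inter> U) \<noteq> {}" for W'
      using that M(2) W(1) by (auto simp: pairwise_def disjnt_def)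
    show "\<exists>V. openin T V \<and> V \<noteq> {} \<and> V \<subseteq> U \<and>
        (\<forall>D1\<in>(\<lambda>W. A \<inter> W) ` \<M>. \<forall>D2\<in>(\<lambda>W. A \<inter> W) ` \<M>.
          D1 \<inter> V \<noteq> {} \<and> D2 \<inter> V \<noteq> {} \<longrightarrow> D1 = D2)"
    proof (intro exI[of _ "W \<inter> U"] conjI ballI impI)
      fix D1 D2 assume "D1 \<in> (\<lambda>W. A \<inter> W) ` \<M>" "D2 \<in> (\<lambda>W. A \<inter> W) ` \<M>"
        "D1 \<inter> (W \<inter> U) \<noteq> {} \<and> D2 \<inter> (W \<inter> U) \<noteq> {}"
      then show "D1 = D2" using * by blast
    qed (use W M(1) U in auto)
  qed (use M(1) in auto)
  moreover have "nowhere_dense_in T (A - \<Union>\<M>)"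
    unfolding nowhere_dense_in_iff
  proof (intro conjI allI impI)
    fix U assume U: "openin T U \<and> U \<noteq> {}"
    then obtain W where "W \<in> \<M>" "W \<inter> U \<noteq> {}" using M(3) by blast
    then show "\<exists>W. openin T W \<and> W \<noteq> {} \<and> W \<subseteq> U \<and> W \<inter> (A - \<Union>\<M>) = {}"
      using M(1) U by (intro exI[of _ "W \<inter> U"]) auto
  qed (use A in blast)
  ultimately have "meagre_in T (\<Union>((\<lambda>W. A \<inter> W) ` \<M>) \<union> (A - \<Union>\<M>))"
    by (simp add: meagre_in_Un nowhere_dense_imp_meagre)
  then show ?thesis by (rule meagre_in_subset) blast
qed

section \<open>Ideals closed under discrete unions\<close>

text \<open>Stone's construction, the device behind paracompactness of metric spaces. It stands in
  for the countable cover by small sets of a separable space.\<close>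

lemma (in Metric_space) sigma_discrete_cover:
  assumes "e > 0"
  shows "\<exists>\<D> :: nat \<Rightarrow> 'a set set. (\<forall>n. discrete_family mtopology (\<D> n)) \<and>
      M \<subseteq> (\<Union>n. \<Union>(\<D> n)) \<and> (\<forall>n. \<forall>D\<in>\<D> n. \<forall>a\<in>D \<inter> M. \<forall>b\<in>D \<inter> M. d a b < e)"
proof -
  obtain r :: "'a rel" where r: "well_order_on UNIV r" using well_order_on by blast
  have wf: "wf (r - Id)" and lin: "\<And>a b. a \<noteq> b \<Longrightarrow> (a, b) \<in> r \<or> (b, a) \<in> r"
    using r by (auto simp: well_order_on_def linear_order_on_def total_on_def)
  text \<open>The cell of level \<open>n\<close> at \<open>t\<close> collects the points for which \<open>t\<close> is the least centre
    within \<open>e/2\<close>, and which are even closer to \<open>t\<close> by a margin \<open>1/(n+1)\<close>; the margin makes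
    the cells of one level uniformly separated.\<close>
  define C where "C n t = {x \<in> M. d x t \<le> e/2 - 1 / real (Suc n) \<and>
      (\<forall>u\<in>M. (u, t) \<in> r - Id \<longrightarrow> e/2 \<le> d x u)}" for n t
  define \<D> where "\<D> n = C n ` M" for n
  have sep: "1 / real (Suc n) \<le> d x y"
    if "s \<in> M" "t \<in> M" "x \<in> C n s" "y \<in> C n t" "s \<noteq> t" for n s t x y
  proof -
    have M: "x \<in> M" "y \<in> M" using that by (auto simp: C_def)
    have "(s, t) \<in> r - Id \<or> (t, s) \<in> r - Id" using lin[of s t] \<open>s \<noteq> t\<close> by auto
    then show ?thesis
    proof
      assume "(s, t) \<in> r - Id"
      then have "e/2 \<le> d y s" "d x s \<le> e/2 - 1 / real (Suc n)" using that by (auto simp: C_def)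
      moreover have "d y s \<le> d y x + d x s" using M that by (intro triangle) auto
      ultimately show ?thesis using commute[of x y] by linarith
    next
      assume "(t, s) \<in> r - Id"
      then have "e/2 \<le> d x t" "d y t \<le> e/2 - 1 / real (Suc n)" using that by (auto simp: C_def)
      moreover have "d x t \<le> d x y + d y t" using M that by (intro triangle) auto
      ultimately show ?thesis by linarith
    qed
  qed
  have "discrete_family mtopology (\<D> n)" for n
    unfolding discrete_family_def
  proof
    fix x assume "x \<in> topspace mtopology"
    then have x: "x \<in> M" by simp
    let ?V = "mball x (1 / (2 * real (Suc n)))"
    have "D1 = D2" if D: "D1 \<in> \<D> n" "D2 \<in> \<D> n" "D1 \<inter> ?V \<noteq> {}" "D2 \<inter> ?V \<noteq> {}" for D1 D2
    proof -
      obtain s t where st: "s \<in> M" "t \<in> M" "D1 = C n s" "D2 = C n t"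
        using \<open>D1 \<in> \<D> n\<close> \<open>D2 \<in> \<D> n\<close> unfolding \<D>_def by (elim imageE) metis
      obtain y z where yz: "y \<in> C n s" "z \<in> C n t" "d x y < 1 / (2 * real (Suc n))"
          "d x z < 1 / (2 * real (Suc n))" "y \<in> M" "z \<in> M"
        using D(3,4) st by auto
      have "d y z \<le> d y x + d x z" using yz x by (intro triangle) auto
      also have "\<dots> < 1 / (2 * real (Suc n)) + 1 / (2 * real (Suc n))"
        using yz commute[of x y] by linarith
      also have "\<dots> = 1 / real (Suc n)" by (simp add: field_simps)
      finally have "s = t" using sep[OF st(1,2) yz(1,2)] by linarith
      then show ?thesis using st by simp
    qed
    then show "\<exists>V. openin mtopology V \<and> x \<in> V \<and>
        (\<forall>E1\<in>\<D> n. \<forall>E2\<in>\<D> n. E1 \<inter> V \<noteq> {} \<and> E2 \<inter> V \<noteq> {} \<longrightarrow> E1 = E2)"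
      using x by (intro exI[of _ ?V] conjI ballI impI) auto
  qed
  moreover have "x \<in> (\<Union>n. \<Union>(\<D> n))" if x: "x \<in> M" for x
  proof -
    have "x \<in> {t \<in> M. d x t < e/2}" using x assms by simp
    then obtain t where t: "t \<in> {t \<in> M. d x t < e/2}"
        and least: "\<And>u. (u, t) \<in> r - Id \<Longrightarrow> u \<notin> {t \<in> M. d x t < e/2}"
      using wfE_min[OF wf, of x "{t \<in> M. d x t < e/2}"] by blast
    obtain n where n: "1 / real (Suc n) < e/2 - d x t"
      using reals_Archimedean[of "e/2 - d x t"] t by (auto simp: inverse_eq_divide)
    have "x \<in> C n t" using n x least by (force simp: C_def)
    then show ?thesis using t by (auto simp: \<D>_def)
  qed
  moreover have "d a b < e" if "D \<in> \<D> n" "a \<in> D \<inter> M" "b \<in> D \<inter> M" for n D a b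
  proof -
    obtain t where t: "t \<in> M" "D = C n t" using \<open>D \<in> \<D> n\<close> by (auto simp: \<D>_def)
    have "d a t \<le> e/2 - 1 / real (Suc n)" "d b t \<le> e/2 - 1 / real (Suc n)"
      using that t by (auto simp: C_def)
    moreover have "d a b \<le> d a t + d t b" using that t by (intro triangle) auto
    moreover have "1 / real (Suc n) > 0" by simp
    ultimately show ?thesis using commute[of b t] by linarith
  qed
  ultimately show ?thesis by (intro exI[of _ \<D>]) blast
qed

text \<open>A sigma-ideal suited to non-separable spaces. Later instances are meagre sets, sets with
  meagre orbit image, sets whose orbit image is countable on a compact set, and sets with meagre
  preimage under a left translation.\<close>

definition d_ideal :: "'a topology \<Rightarrow> ('a set \<Rightarrow> bool) \<Rightarrow> bool" where
  "d_ideal T small \<longleftrightarrow>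
     (\<forall>E F. small E \<and> F \<subseteq> E \<longrightarrow> small F) \<and>
     (\<forall>F :: nat \<Rightarrow> 'a set. (\<forall>n. small (F n)) \<longrightarrow> small (\<Union>n. F n)) \<and>
     (\<forall>\<E>. discrete_family T \<E> \<and> (\<forall>E\<in>\<E>. small E) \<longrightarrow> small (\<Union>\<E>))"

lemma d_idealI:
  assumes "\<And>E F. small E \<Longrightarrow> F \<subseteq> E \<Longrightarrow> small F"
    and "\<And>F :: nat \<Rightarrow> 'a set. (\<And>n. small (F n)) \<Longrightarrow> small (\<Union>n. F n)"
    and "\<And>\<E>. discrete_family T \<E> \<Longrightarrow> (\<And>E. E \<in> \<E> \<Longrightarrow> small E) \<Longrightarrow> small (\<Union>\<E>)"
  shows "d_ideal T small"
  unfolding d_ideal_def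
proof (intro conjI allI impI)
  show "\<And>E F. small E \<and> F \<subseteq> E \<Longrightarrow> small F" using assms(1) by blast
  show "\<And>F :: nat \<Rightarrow> 'a set. \<forall>n. small (F n) \<Longrightarrow> small (\<Union>n. F n)"
    by (rule assms(2)) simp
  show "\<And>\<E>. discrete_family T \<E> \<and> (\<forall>E\<in>\<E>. small E) \<Longrightarrow> small (\<Union>\<E>)"
    by (rule assms(3)) simp_all
qed

lemma d_ideal_subset: "d_ideal T small \<Longrightarrow> small E \<Longrightarrow> F \<subseteq> E \<Longrightarrow> small F"
  unfolding d_ideal_def by blast

lemma d_ideal_UN:
  fixes F :: "nat \<Rightarrow> 'a set"
  shows "d_ideal T small \<Longrightarrow> (\<And>n. small (F n)) \<Longrightarrow> small (\<Union>n. F n)"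
  unfolding d_ideal_def by blast

lemma d_ideal_Union:
  "d_ideal T small \<Longrightarrow> discrete_family T \<E> \<Longrightarrow> (\<And>E. E \<in> \<E> \<Longrightarrow> small E) \<Longrightarrow> small (\<Union>\<E>)"
  unfolding d_ideal_def by blast

lemma d_ideal_Un:
  assumes "d_ideal T small" "small E" "small F"
  shows "small (E \<union> F)"
proof -
  have "small (\<Union>n::nat. if n = 0 then E else F)"
    by (rule d_ideal_UN[OF assms(1)]) (use assms in auto)
  then show ?thesis by (rule d_ideal_subset[OF assms(1)]) (auto split: if_splits)
qed

text \<open>For some \<open>m\<close> the part of \<open>E\<close> where the radius exceeds
  \<open>1 / Suc m\<close> is not small. A sigma-discrete cover of mesh below this bound has
  countably many levels, each discrete, so one single cell carries a part that is not small. The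
  result lies in the ball of radius \<open>r a\<close> around each of its own points
  \<open>a\<close>.\<close>

lemma (in Metric_space) d_ideal_cell:
  assumes I: "d_ideal mtopology small" and E: "E \<subseteq> M" "\<not> small E"
    and r: "\<And>a. a \<in> E \<Longrightarrow> r a > 0"
  shows "\<exists>E'\<subseteq>E. \<not> small E' \<and> (\<forall>a\<in>E'. \<forall>b\<in>E'. d b a < r a)"
proof -
  have "E = (\<Union>m. {a\<in>E. 1 / real (Suc m) < r a})"
    using r reals_Archimedean by (fastforce simp: inverse_eq_divide)
  then obtain m where m: "\<not> small {a\<in>E. 1 / real (Suc m) < r a}"
    using d_ideal_UN[OF I] E(2) by (metis (no_types, lifting))
  let ?F = "{a\<in>E. 1 / real (Suc m) < r a}"
  obtain \<D> where D: "\<And>n::nat. discrete_family mtopology (\<D> n)" "M \<subseteq> (\<Union>n. \<Union>(\<D> n))"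
    "\<And>n D a b. D \<in> \<D> n \<Longrightarrow> a \<in> D \<inter> M \<Longrightarrow> b \<in> D \<inter> M \<Longrightarrow> d a b < 1 / real (Suc m)"
    using sigma_discrete_cover[of "1 / real (Suc m)"]
    by (metis of_nat_0_less_iff zero_less_Suc zero_less_divide_1_iff)
  have "?F \<subseteq> (\<Union>n. \<Union>(\<D> n))" using D(2) E(1) by auto
  then have F: "?F \<subseteq> (\<Union>n. \<Union>((\<lambda>D. D \<inter> ?F) ` \<D> n))" by blast
  then obtain n where n: "\<not> small (\<Union>((\<lambda>D. D \<inter> ?F) ` \<D> n))"
    using m d_ideal_UN[OF I, of "\<lambda>n. \<Union>((\<lambda>D. D \<inter> ?F) ` \<D> n)"] d_ideal_subset[OF I _ F]
    by blast
  have "discrete_family mtopology ((\<lambda>D. D \<inter> ?F) ` \<D> n)"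
    by (rule discrete_family_subsets[OF D(1)]) auto
  then obtain D0 where D0: "D0 \<in> \<D> n" "\<not> small (D0 \<inter> ?F)"
    using d_ideal_Union[OF I] n by blast
  have "d b a < r a" if "a \<in> D0 \<inter> ?F" "b \<in> D0 \<inter> ?F" for a b
    using D(3)[OF D0(1), of b a] that E(1) by force
  then show ?thesis using D0(2) by (intro exI[of _ "D0 \<inter> ?F"]) auto
qed

lemma d_ideal_meagre: "d_ideal T (meagre_in T)"
proof (rule d_idealI)
  show "meagre_in T (\<Union>n. F n)" if "\<And>n::nat. meagre_in T (F n)" for F
    using that by (simp add: meagre_in_UN)
qed (fact meagre_in_subset meagre_in_discrete_Union)+

text \<open>\<open>A s\<close> is the union of the branches of a Souslin scheme through the node \<open>s\<close>. The points of
  a Cauchy sequence that runs along a branch converge inside the space.\<close>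
definition (in Metric_space) analytic_scheme :: "(nat list \<Rightarrow> 'a set) \<Rightarrow> bool" where
  "analytic_scheme A \<longleftrightarrow> A [] = M \<and> (\<forall>s. A s = (\<Union>k. A (s @ [k]))) \<and>
     (\<forall>i e. (\<forall>n. e n \<in> A (map i [0..<n])) \<and> MCauchy e \<longrightarrow> (\<exists>l. limitin mtopology e l sequentially))"

lemma (in Metric_space) d_ideal_scheme_cell:
  assumes I: "d_ideal mtopology small" and A: "analytic_scheme A"
    and E: "E \<subseteq> A s" "E \<subseteq> M" "\<not> small E" and e: "e > 0"
  shows "\<exists>E' k. E' \<subseteq> E \<and> E' \<subseteq> A (s @ [k]) \<and> \<not> small E' \<and> (\<forall>a\<in>E'. \<forall>b\<in>E'. d a b < e)"
proof -
  have "A s = (\<Union>k. A (s @ [k]))" using A unfolding analytic_scheme_def by (elim conjE) (erule spec)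
  with E(1) have "E \<subseteq> (\<Union>k. A (s @ [k]))" by (rule subset_trans[OF _ equalityD1])
  then have "(\<Union>k. E \<inter> A (s @ [k])) = E" by auto
  then have "\<exists>k. \<not> small (E \<inter> A (s @ [k]))"
    using d_ideal_UN[OF I, of "\<lambda>k. E \<inter> A (s @ [k])"] E(3) by metis
  then obtain k where k: "\<not> small (E \<inter> A (s @ [k]))" by blast
  have "E \<inter> A (s @ [k]) \<subseteq> M" using E(2) by blast
  then obtain E' where "E' \<subseteq> E \<inter> A (s @ [k])" "\<not> small E'" "\<forall>a\<in>E'. \<forall>b\<in>E'. d b a < e"
    using d_ideal_cell[OF I _ k, of "\<lambda>_. e"] e by metis
  then show ?thesis by (intro exI[of _ E'] exI[of _ k]) auto
qed

text \<open>\<open>A s\<close> keeps the points with an admissible branch starting with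
  \<open>s\<close>. Completeness of \<open>Y\<close> only gives a limit \<open>y\<close> of the
  images; it belongs to every closed set \<open>H\<close> along \<open>i\<close>, and the
  intersection of these lies in the image of \<open>M\<close>.\<close>

lemma analytic_via_scheme:
  assumes M: "Metric_space M d" and an: "analytic_via TYPE('c) M d"
  shows "\<exists>A. Metric_space.analytic_scheme M d A"
proof -
  interpret Metric_space M d by fact
  obtain Y :: "'c set" and dY f and H :: "nat list \<Rightarrow> 'c set" where
    Y: "Metric_space Y dY" "Metric_space.mcomplete Y dY" and
    f: "f ` M \<subseteq> Y" "\<And>x y. x \<in> M \<Longrightarrow> y \<in> M \<Longrightarrow> dY (f x) (f y) = d x y" and
    H: "\<And>s. closedin (Metric_space.mtopology Y dY) (H s)"
      "f ` M = (\<Union>i::nat \<Rightarrow> nat. \<Inter>n. H (map i [0..<Suc n]))"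
    using an unfolding analytic_via_def souslin_F_def by (elim exE conjE) (rule that; force)
  interpret Y: Metric_space Y dY by fact
  define A where "A s = {x \<in> M. \<exists>i::nat \<Rightarrow> nat. map i [0..<length s] = s \<and>
      f x \<in> (\<Inter>n. H (map i [0..<Suc n]))}" for s
  have "A [] = M"
  proof
    show "M \<subseteq> A []"
    proof
      fix x assume x: "x \<in> M"
      then have "f x \<in> (\<Union>i::nat \<Rightarrow> nat. \<Inter>n. H (map i [0..<Suc n]))" using H(2) by blast
      then obtain i :: "nat \<Rightarrow> nat" where "f x \<in> (\<Inter>n. H (map i [0..<Suc n]))" by blast
      then show "x \<in> A []" using x by (auto simp: A_def)
    qed
  qed (auto simp: A_def)
  moreover have "A s = (\<Union>k. A (s @ [k]))" for s
  proof
    show "A s \<subseteq> (\<Union>k. A (s @ [k]))"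
    proof
      fix x assume "x \<in> A s"
      then obtain i :: "nat \<Rightarrow> nat" where i: "x \<in> M" "map i [0..<length s] = s"
        "f x \<in> (\<Inter>n. H (map i [0..<Suc n]))" by (auto simp: A_def)
      then have "map i [0..<length (s @ [i (length s)])] = s @ [i (length s)]" by simp
      then have "x \<in> A (s @ [i (length s)])" using i unfolding A_def by blast
      then show "x \<in> (\<Union>k. A (s @ [k]))" by blast
    qed
    show "(\<Union>k. A (s @ [k])) \<subseteq> A s"
    proof
      fix x assume "x \<in> (\<Union>k. A (s @ [k]))"
      then obtain k i where i: "x \<in> M" "map i [0..<length (s @ [k])] = s @ [k]"
        "f x \<in> (\<Inter>n. H (map i [0..<Suc n]))" unfolding A_def by blast
      then have "map i [0..<length s] = s" by simp
      then show "x \<in> A s" using i unfolding A_def by blast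
    qed
  qed
  moreover have "\<exists>l. limitin mtopology e l sequentially"
    if e: "\<forall>n. e n \<in> A (map i [0..<n])" and C: "MCauchy e" for i e
  proof -
    have eM: "e n \<in> M" for n using e by (auto simp: A_def)
    have "Y.MCauchy (f \<circ> e)"
      using C eM f unfolding Y.MCauchy_def MCauchy_def by (auto simp: image_subset_iff)
    then obtain y where y: "limitin Y.mtopology (f \<circ> e) y sequentially"
      using Y(2) by (auto simp: Y.mcomplete_def)
    have "y \<in> H (map i [0..<Suc n])" for n
    proof (rule limitin_closedin[OF y H(1)])
      show "\<forall>\<^sub>F m in sequentially. (f \<circ> e) m \<in> H (map i [0..<Suc n])"
        unfolding eventually_sequentially
      proof (intro exI[of _ "Suc n"] allI impI)
        fix m assume m: "Suc n \<le> m"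
        \<comment> \<open>The branch \<open>j\<close> of \<open>e m\<close> agrees with
          \<open>i\<close> on its first \<open>m\<close> entries only, so both select the same set
          \<open>H\<close> once \<open>m\<close> reaches \<open>Suc n\<close>.\<close>
        obtain j where j: "map j [0..<m] = map i [0..<m]"
            "f (e m) \<in> (\<Inter>n. H (map j [0..<Suc n]))"
          using e[rule_format, of m] by (auto simp: A_def)
        have "map j [0..<Suc n] = map i [0..<Suc n]"
          using j(1) m by (simp del: upt_Suc)
        then show "(f \<circ> e) m \<in> H (map i [0..<Suc n])" using j(2) by (metis INT_E UNIV_I comp_apply)
      qed
    qed simp
    then have "y \<in> f ` M" using H(2) by blast
    then obtain l where l: "l \<in> M" "y = f l" by blast
    have "limitin mtopology e l sequentially"
      using y l eM f unfolding Y.limitin_metric limitin_metric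
      by (simp add: image_subset_iff)
    then show ?thesis by blast
  qed
  ultimately have "analytic_scheme A" unfolding analytic_scheme_def by blast
  then show ?thesis by blast
qed

lemma (in Metric_space)
  assumes "analytic_scheme A"
  shows analytic_scheme_Nil: "A [] = M"
    and analytic_scheme_limit: "(\<And>n. e n \<in> A (map i [0..<n])) \<Longrightarrow> MCauchy e \<Longrightarrow>
      \<exists>l. limitin mtopology e l sequentially"
  using assms unfolding analytic_scheme_def by blast+

lemma non_meagre_everywhere_in:
  assumes "X \<subseteq> topspace T" "\<not> meagre_in T X"
  obtains U where "openin T U" "U \<noteq> {}"
    "\<And>W. openin T W \<Longrightarrow> W \<noteq> {} \<Longrightarrow> W \<subseteq> U \<Longrightarrow> \<not> meagre_in T (X \<inter> W)"
  using Banach_category[OF assms(1)] assms(2) by metis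

text \<open>This replaces the theorem that analytic sets have the Baire property. The tree of
  maximal disjoint families below picks, for comeagre many \<open>t\<close>, a branch of the scheme along which
  the images accumulate at \<open>t\<close>.\<close>
lemma (in Metric_space) comeagre_limits:
  fixes \<pi> :: "'a \<Rightarrow> 'b"
  assumes N: "Metric_space N dN" and A: "analytic_scheme A"
    and E0: "E0 \<subseteq> M" "\<pi> ` E0 \<subseteq> N"
    and disc: "\<And>\<E>. discrete_family mtopology \<E> \<Longrightarrow>
      (\<And>E. E \<in> \<E> \<Longrightarrow> E \<subseteq> E0 \<and> meagre_in (Metric_space.mtopology N dN) (\<pi> ` E)) \<Longrightarrow>
      meagre_in (Metric_space.mtopology N dN) (\<pi> ` \<Union>\<E>)"
    and nonm: "\<not> meagre_in (Metric_space.mtopology N dN) (\<pi> ` E0)"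
  shows "\<exists>U. openin (Metric_space.mtopology N dN) U \<and> U \<noteq> {} \<and>
    meagre_in (Metric_space.mtopology N dN) (U - {t. \<exists>e l. (\<forall>n. e n \<in> E0) \<and>
      limitin mtopology e l sequentially \<and>
      limitin (Metric_space.mtopology N dN) (\<lambda>n. \<pi> (e n)) t sequentially})"
proof -
  interpret N: Metric_space N dN by fact
  define T where "T = N.mtopology"
  \<comment> \<open>\<open>disc\<close> speaks only of subsets of \<open>E0\<close>, hence the
    intersection.\<close>
  define small where "small E \<longleftrightarrow> meagre_in T (\<pi> ` (E \<inter> E0))" for E
  have I: "d_ideal mtopology small"
  proof (rule d_idealI)
    fix E F assume "small E" "F \<subseteq> E"
    then show "small F" unfolding small_def by (elim meagre_in_subset) blast
  next
    fix F :: "nat \<Rightarrow> 'a set" assume "\<And>n. small (F n)"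
    then have "meagre_in T (\<Union>n. \<pi> ` (F n \<inter> E0))" by (intro meagre_in_UN) (auto simp: small_def)
    then show "small (\<Union>n. F n)" unfolding small_def by (rule meagre_in_subset) blast
  next
    fix \<E> assume "discrete_family mtopology \<E>" "\<And>E. E \<in> \<E> \<Longrightarrow> small E"
    then have "meagre_in T (\<pi> ` \<Union>((\<lambda>E. E \<inter> E0) ` \<E>))"
      unfolding T_def by (intro disc discrete_family_subsets) (auto simp: small_def T_def)
    then show "small (\<Union>\<E>)" unfolding small_def by (rule meagre_in_subset) blast
  qed
  define full where "full E U \<longleftrightarrow> (\<forall>W. openin T W \<and> W \<noteq> {} \<and> W \<subseteq> U \<longrightarrow> \<not> meagre_in T (\<pi> ` E \<inter> W))"
    for E U
  \<comment> \<open>A node is an open set, a set whose image is non-meagre in each of its open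
    parts, and an address in the scheme. Level 0 is exempt from the diameter bound because
    \<open>1 / 0\<close> is 0.\<close>
  define valid where "valid n p \<longleftrightarrow> (case p of (U, E, s) \<Rightarrow> openin T U \<and> U \<noteq> {} \<and> E \<subseteq> E0 \<and> E \<subseteq> A s \<and>
      full E U \<and> (n = 0 \<or> (\<forall>a\<in>E. \<forall>b\<in>E. d a b < 1 / real n)))" for n :: nat and p
  define child where "child n p q \<longleftrightarrow> valid (Suc n) q \<and> fst q \<subseteq> fst p \<and> fst (snd q) \<subseteq> fst (snd p) \<and>
      (\<exists>k. snd (snd q) = snd (snd p) @ [k])" for n p q
  \<comment> \<open>Disjointness lets a point select a single branch; density of the union keeps the
    loss at each level nowhere dense.\<close>
  define children where "children n p C \<longleftrightarrow> (\<forall>q\<in>C. child n p q) \<and>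
      (\<forall>q\<in>C. \<forall>q'\<in>C. q \<noteq> q' \<longrightarrow> fst q \<inter> fst q' = {}) \<and>
      (\<forall>W. openin T W \<and> W \<noteq> {} \<and> W \<subseteq> fst p \<longrightarrow> (\<exists>q\<in>C. fst q \<inter> W \<noteq> {}))" for n p C
  have "\<exists>C. children n p C" if "valid n p" for n p
  proof -
    obtain U E s where p: "p = (U, E, s)" by (cases p)
    have v: "E \<subseteq> E0" "E \<subseteq> A s" "full E U" using that by (auto simp: valid_def p)
    define Q where "Q W \<longleftrightarrow> (\<exists>E' k. E' \<subseteq> E \<and> E' \<subseteq> A (s @ [k]) \<and> full E' W \<and>
        (\<forall>a\<in>E'. \<forall>b\<in>E'. d a b < 1 / real (Suc n)))" for W
    have "\<exists>W. openin T W \<and> W \<noteq> {} \<and> W \<subseteq> U1 \<and> Q W"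
      if U1: "openin T U1" "U1 \<noteq> {}" "U1 \<subseteq> U" for U1
    proof -
      let ?E = "E \<inter> \<pi> -` U1"
      have "\<pi> ` E \<inter> U1 = \<pi> ` (?E \<inter> E0)" using v(1) by auto
      then have "\<not> small ?E" using v(3) U1 by (auto simp: full_def small_def)
      moreover have "?E \<subseteq> A s" "?E \<subseteq> M" using v E0 by auto
      moreover have "1 / real (Suc n) > 0" by simp
      ultimately obtain E' k where E': "E' \<subseteq> ?E" "E' \<subseteq> A (s @ [k])" "\<not> small E'"
          "\<forall>a\<in>E'. \<forall>b\<in>E'. d a b < 1 / real (Suc n)"
        using d_ideal_scheme_cell[OF I A] by metis
      have "E' \<inter> E0 = E'" using E'(1) v(1) by blast
      then have "\<not> meagre_in T (\<pi> ` E')" using E'(3) by (simp add: small_def)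
      moreover have "\<pi> ` E' \<subseteq> topspace T"
        using E'(1) v(1) E0(2) unfolding T_def N.topspace_mtopology by blast
      ultimately obtain W where W: "openin T W" "W \<noteq> {}"
          "\<And>W'. openin T W' \<Longrightarrow> W' \<noteq> {} \<Longrightarrow> W' \<subseteq> W \<Longrightarrow> \<not> meagre_in T (\<pi> ` E' \<inter> W')"
        using non_meagre_everywhere_in by metis
      have "\<pi> ` E' \<inter> W \<noteq> {}" using W(3)[OF W(1,2)] meagre_in_empty by fastforce
      then have "W \<inter> U1 \<noteq> {}" using E'(1) by blast
      moreover have "full E' (W \<inter> U1)" using W(3) by (simp add: full_def)
      moreover have "E' \<subseteq> E" using E'(1) by blast
      ultimately have "openin T (W \<inter> U1) \<and> W \<inter> U1 \<noteq> {} \<and> W \<inter> U1 \<subseteq> U1 \<and> Q (W \<inter> U1)"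
        unfolding Q_def using W(1) U1(1) E'(2,4) by (auto intro: openin_Int)
      then show ?thesis by (rule exI)
    qed
    then have "\<exists>\<M>. (\<forall>W\<in>\<M>. openin T W \<and> W \<noteq> {} \<and> W \<subseteq> U \<and> Q W) \<and> disjoint \<M> \<and>
        (\<forall>U1. openin T U1 \<and> U1 \<noteq> {} \<and> U1 \<subseteq> U \<longrightarrow> (\<exists>W\<in>\<M>. W \<inter> U1 \<noteq> {}))"
      by (rule maximal_disjoint_open)
    then obtain \<M> where M: "\<And>W. W \<in> \<M> \<Longrightarrow> openin T W \<and> W \<noteq> {} \<and> W \<subseteq> U \<and> Q W" "disjoint \<M>"
      "\<And>U1. openin T U1 \<Longrightarrow> U1 \<noteq> {} \<Longrightarrow> U1 \<subseteq> U \<Longrightarrow> \<exists>W\<in>\<M>. W \<inter> U1 \<noteq> {}" by metis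
    have "\<forall>W\<in>\<M>. \<exists>E' k. E' \<subseteq> E \<and> E' \<subseteq> A (s @ [k]) \<and> full E' W \<and>
        (\<forall>a\<in>E'. \<forall>b\<in>E'. d a b < 1 / real (Suc n))" using M(1) by (simp add: Q_def)
    then obtain e k where ek: "\<And>W. W \<in> \<M> \<Longrightarrow> e W \<subseteq> E \<and> e W \<subseteq> A (s @ [k W]) \<and> full (e W) W \<and>
        (\<forall>a\<in>e W. \<forall>b\<in>e W. d a b < 1 / real (Suc n))" by metis
    let ?C = "(\<lambda>W. (W, e W, s @ [k W])) ` \<M>"
    have "child n p q" if q: "q \<in> ?C" for q
    proof -
      obtain W where W: "W \<in> \<M>" "q = (W, e W, s @ [k W])" using q by blast
      have "e W \<subseteq> E0" using ek[OF W(1)] v(1) by auto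
      then have "valid (Suc n) q"
        using ek[OF W(1)] M(1)[OF W(1)] by (simp add: valid_def W(2))
      then show ?thesis using ek[OF W(1)] M(1)[OF W(1)] by (simp add: child_def p W(2))
    qed
    moreover have "fst q \<inter> fst q' = {}" if q: "q \<in> ?C" "q' \<in> ?C" "q \<noteq> q'" for q q'
    proof -
      obtain W W' where W: "W \<in> \<M>" "q = (W, e W, s @ [k W])"
          "W' \<in> \<M>" "q' = (W', e W', s @ [k W'])" using q(1,2) by blast
      then have "W \<noteq> W'" using q(3) by blast
      then show ?thesis using M(2) W by (simp add: pairwise_def disjnt_def)
    qed
    moreover have "\<exists>q\<in>?C. fst q \<inter> W \<noteq> {}" if "openin T W" "W \<noteq> {}" "W \<subseteq> fst p" for W
      using M(3)[of W] that by (auto simp: p)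
    ultimately show ?thesis unfolding children_def by (intro exI[of _ ?C]) simp
  qed
  then obtain C where "\<And>n p. valid n p \<Longrightarrow> children n p (C n p)" by metis
  then have C: "\<And>n p q. valid n p \<Longrightarrow> q \<in> C n p \<Longrightarrow> child n p q"
    "\<And>n p q q'. valid n p \<Longrightarrow> q \<in> C n p \<Longrightarrow> q' \<in> C n p \<Longrightarrow> q \<noteq> q' \<Longrightarrow> fst q \<inter> fst q' = {}"
    "\<And>n p W. valid n p \<Longrightarrow> openin T W \<Longrightarrow> W \<noteq> {} \<Longrightarrow> W \<subseteq> fst p \<Longrightarrow> \<exists>q\<in>C n p. fst q \<inter> W \<noteq> {}"
    by (simp_all add: children_def)
  have "\<pi> ` E0 \<subseteq> topspace T" using E0 by (simp add: T_def)
  moreover have "\<not> meagre_in T (\<pi> ` E0)" using nonm by (simp add: T_def)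
  ultimately obtain U0 where U0: "openin T U0" "U0 \<noteq> {}"
      "\<And>W'. openin T W' \<Longrightarrow> W' \<noteq> {} \<Longrightarrow> W' \<subseteq> U0 \<Longrightarrow> \<not> meagre_in T (\<pi> ` E0 \<inter> W')"
    by (rule non_meagre_everywhere_in) (rule that)
  define V where "V = rec_nat {(U0, E0, [])} (\<lambda>n S. \<Union>p\<in>S. C n p)"
  have V0: "V 0 = {(U0, E0, [])}" and VS: "V (Suc n) = (\<Union>p\<in>V n. C n p)" for n
    by (simp_all add: V_def)
  have A0: "E0 \<subseteq> A []" using analytic_scheme_Nil[OF A] E0(1) by simp
  have valid: "valid n p" if "p \<in> V n" for n p
    using that
  proof (induction n arbitrary: p)
    case 0
    then show ?case using U0 A0 by (simp add: V0 valid_def full_def)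
  next
    case (Suc n)
    then obtain q where "q \<in> V n" "p \<in> C n q" by (auto simp: VS)
    then show ?case using C(1)[OF Suc.IH] unfolding child_def by blast
  qed
  have VC: "child n p q" if "p \<in> V n" "q \<in> C n p" for n p q using C(1) valid that by blast
  have disj: "fst p \<inter> fst q = {}" if "p \<in> V n" "q \<in> V n" "p \<noteq> q" for n p q
    using that
  proof (induction n arbitrary: p q)
    case (Suc n)
    then obtain p' q' where p': "p' \<in> V n" "p \<in> C n p'" and q': "q' \<in> V n" "q \<in> C n q'"
      by (auto simp: VS)
    show ?case
    proof (cases "p' = q'")
      case True
      then show ?thesis using C(2)[OF valid[OF p'(1)]] p' q' Suc.prems(3) by blast
    next
      case False
      then have "fst p' \<inter> fst q' = {}" using Suc.IH p' q' by blast
      then show ?thesis using VC[OF p'] VC[OF q'] by (auto simp: child_def)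
    qed
  qed (simp add: V0)
  have dense: "\<exists>p\<in>V n. fst p \<inter> W \<noteq> {}" if "openin T W" "W \<noteq> {}" "W \<subseteq> U0" for n W
  proof (induction n)
    case 0
    then show ?case using that by (auto simp: V0)
  next
    case (Suc n)
    then obtain p where p: "p \<in> V n" "fst p \<inter> W \<noteq> {}" by blast
    have "openin T (fst p)" using valid[OF p(1)] by (auto simp: valid_def)
    then have "\<exists>q\<in>C n p. fst q \<inter> (fst p \<inter> W) \<noteq> {}"
      using C(3)[OF valid[OF p(1)], of "fst p \<inter> W"] p(2) that by (auto intro: openin_Int)
    then show ?case using p(1) by (auto simp: VS)
  qed
  let ?G = "{t. \<exists>e l. (\<forall>n. e n \<in> E0) \<and> limitin mtopology e l sequentially \<and>
      limitin T (\<lambda>n. \<pi> (e n)) t sequentially}"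
  have "nowhere_dense_in T (U0 - (\<Union>p\<in>V n. fst p))" for n
    unfolding nowhere_dense_in_iff
  proof (intro conjI allI impI)
    show "U0 - (\<Union>p\<in>V n. fst p) \<subseteq> topspace T" using openin_subset[OF U0(1)] by blast
    fix W assume W: "openin T W \<and> W \<noteq> {}"
    show "\<exists>W'. openin T W' \<and> W' \<noteq> {} \<and> W' \<subseteq> W \<and> W' \<inter> (U0 - (\<Union>p\<in>V n. fst p)) = {}"
    proof (cases "W \<inter> U0 = {}")
      case True
      then show ?thesis using W by (intro exI[of _ W]) auto
    next
      case False
      then obtain p where p: "p \<in> V n" "fst p \<inter> (W \<inter> U0) \<noteq> {}"
        using dense[of "W \<inter> U0"] W U0(1) by (meson inf.cobounded2 openin_Int)
      have "openin T (fst p)" using valid[OF p(1)] by (auto simp: valid_def)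
      then show ?thesis using p W by (intro exI[of _ "fst p \<inter> W"]) auto
    qed
  qed
  then have "meagre_in T (\<Union>n. U0 - (\<Union>p\<in>V n. fst p))"
    by (intro meagre_in_UN nowhere_dense_imp_meagre) auto
  moreover have "U0 - ?G \<subseteq> (\<Union>n. U0 - (\<Union>p\<in>V n. fst p))"
  proof
    fix t assume t: "t \<in> U0 - ?G"
    show "t \<in> (\<Union>n. U0 - (\<Union>p\<in>V n. fst p))"
    proof (rule ccontr)
      assume "t \<notin> (\<Union>n. U0 - (\<Union>p\<in>V n. fst p))"
      then have "\<forall>n. \<exists>p\<in>V n. t \<in> fst p" using t by blast
      then obtain p where p: "\<And>n. p n \<in> V n" "\<And>n. t \<in> fst (p n)" by metis
      \<comment> \<open>The nodes \<open>p n\<close> were chosen level by level; disjointness forces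
        the parent of \<open>p (Suc n)\<close> to be \<open>p n\<close>, so they form a
        branch.\<close>
      have child: "child n (p n) (p (Suc n))" for n
      proof -
        obtain q where q: "q \<in> V n" "p (Suc n) \<in> C n q" using p(1)[of "Suc n"] by (auto simp: VS)
        have "t \<in> fst q" using VC[OF q] p(2)[of "Suc n"] by (auto simp: child_def)
        then have "q = p n" using disj[OF q(1) p(1)] p(2)[of n] by blast
        then show ?thesis using VC[OF q] by simp
      qed
      then obtain k where k: "\<And>n. snd (snd (p (Suc n))) = snd (snd (p n)) @ [k n]"
        unfolding child_def by metis
      have s: "snd (snd (p n)) = map k [0..<n]" for n
      proof (induction n)
        case 0
        then show ?case using p(1)[of 0] by (simp add: V0)
      qed (simp add: k)
      have mono: "fst (snd (p n)) \<subseteq> fst (snd (p m))" if "m \<le> n" for m n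
        by (rule lift_Suc_antimono_le[of "\<lambda>n. fst (snd (p n))", OF _ that])
          (use child in \<open>simp add: child_def\<close>)
      have tN: "t \<in> N" using t openin_subset[OF U0(1)] by (auto simp: T_def)
      have pv: "full (fst (snd (p n))) (fst (p n))" "openin T (fst (p n))"
          "fst (snd (p n)) \<subseteq> A (snd (snd (p n)))" "fst (snd (p n)) \<subseteq> E0" for n
        using valid[OF p(1)[of n]] by (auto simp: valid_def)
      \<comment> \<open>Fullness at work: the trace on a neighbourhood of \<open>t\<close> is
        non-meagre, hence non-empty.\<close>
      have "\<exists>x\<in>fst (snd (p n)). \<pi> x \<in> N.mball t (1 / real (Suc n))" for n
      proof -
        let ?B = "fst (p n) \<inter> N.mball t (1 / real (Suc n))"
        have "openin T ?B" using pv(2)[of n] by (auto simp: T_def intro: openin_Int)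
        moreover have "t \<in> ?B" using p(2)[of n] tN by simp
        ultimately have "\<not> meagre_in T (\<pi> ` fst (snd (p n)) \<inter> ?B)"
          using pv(1)[of n] unfolding full_def by blast
        then have "\<pi> ` fst (snd (p n)) \<inter> ?B \<noteq> {}" using meagre_in_empty by metis
        then show ?thesis by blast
      qed
      then obtain e where e: "\<And>n. e n \<in> fst (snd (p n))"
        "\<And>n. \<pi> (e n) \<in> N.mball t (1 / real (Suc n))" by metis
      have eE: "e n \<in> E0" for n using e(1)[of n] pv(4)[of n] by blast
      have "MCauchy e"
        unfolding MCauchy_def
      proof (intro conjI allI impI)
        show "range e \<subseteq> M" using eE E0 by blast
        fix \<epsilon> :: real assume "\<epsilon> > 0"
        then obtain n where n: "1 / real (Suc n) < \<epsilon>" using reals_Archimedean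
          by (auto simp: inverse_eq_divide)
        have "d (e i) (e j) < \<epsilon>" if "Suc n \<le> i" "Suc n \<le> j" for i j
        proof -
          have "e i \<in> fst (snd (p (Suc n)))" "e j \<in> fst (snd (p (Suc n)))"
            using e(1) mono that by blast+
          then have "d (e i) (e j) < 1 / real (Suc n)"
            using valid[OF p(1)[of "Suc n"]] by (auto simp: valid_def split: prod.splits)
          then show ?thesis using n by simp
        qed
        then show "\<exists>N. \<forall>n n'. N \<le> n \<longrightarrow> N \<le> n' \<longrightarrow> d (e n) (e n') < \<epsilon>" by blast
      qed
      moreover have "e n \<in> A (map k [0..<n])" for n using e(1)[of n] pv(3)[of n] s[of n] by auto
      ultimately obtain l where l: "limitin mtopology e l sequentially"
        using analytic_scheme_limit[OF A] by blast
      have "limitin T (\<lambda>n. \<pi> (e n)) t sequentially"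
        unfolding T_def N.limitin_metric eventually_sequentially
      proof (intro conjI allI impI tN)
        fix \<epsilon> :: real assume "\<epsilon> > 0"
        then obtain n where n: "1 / real (Suc n) < \<epsilon>" using reals_Archimedean
          by (auto simp: inverse_eq_divide)
        show "\<exists>K. \<forall>m\<ge>K. \<pi> (e m) \<in> N \<and> dN (\<pi> (e m)) t < \<epsilon>"
        proof (intro exI[of _ n] allI impI)
          fix m assume "n \<le> m"
          then have "1 / real (Suc m) \<le> 1 / real (Suc n)" by (simp add: frac_le)
          then show "\<pi> (e m) \<in> N \<and> dN (\<pi> (e m)) t < \<epsilon>"
            using e(2)[of m] n N.commute[of t "\<pi> (e m)"] by auto
        qed
      qed
      then have "t \<in> ?G" using eE l by blast
      then show False using t by blast
    qed
  qed
  ultimately have "meagre_in T (U0 - ?G)" by (rule meagre_in_subset)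
  then show ?thesis using U0(1,2) unfolding T_def by blast
qed

text \<open>If \<open>E\<close> cannot be split, then at every scale all of \<open>E\<close> up to a
  small set maps close to one point, as otherwise a cell on which \<open>\<psi>\<close> varies
  little would be separated from a non-small rest. What remains over all scales lies in a single
  fibre, so \<open>E\<close> would be small.\<close>

lemma (in Metric_space) d_ideal_split:
  fixes \<psi> :: "'a \<Rightarrow> 'x::metric_space"
  assumes I: "d_ideal mtopology small" and \<psi>: "continuous_map mtopology euclidean \<psi>"
    and fibre: "\<And>p. small {a \<in> M. \<psi> a = p}"
    and E: "E \<subseteq> M" "\<not> small E"
  shows "\<exists>E1 E2 \<delta>. E1 \<subseteq> E \<and> E2 \<subseteq> E \<and> \<not> small E1 \<and> \<not> small E2 \<and> \<delta> > 0 \<and>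
      (\<forall>a\<in>E1. \<forall>b\<in>E2. \<delta> \<le> dist (\<psi> a) (\<psi> b))"
proof (rule ccontr)
  assume no: "\<not> ?thesis"
  have rad: "\<exists>r>0. \<forall>b\<in>M. d b a < r \<longrightarrow> dist (\<psi> b) (\<psi> a) < \<epsilon>" if "a \<in> M" "\<epsilon> > 0" for a \<epsilon>
  proof -
    have "openin mtopology {b \<in> M. \<psi> b \<in> ball (\<psi> a) \<epsilon>}"
      using openin_continuous_map_preimage[OF \<psi>, of "ball (\<psi> a) \<epsilon>"] by simp
    moreover have "a \<in> {b \<in> M. \<psi> b \<in> ball (\<psi> a) \<epsilon>}" using that by simp
    ultimately obtain r where "r > 0" "mball a r \<subseteq> {b \<in> M. \<psi> b \<in> ball (\<psi> a) \<epsilon>}"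
      unfolding openin_mtopology by blast
    then show ?thesis using that commute by (intro exI[of _ r]) (force simp: dist_commute)
  qed
  have "\<exists>x. small {g \<in> E. 2 * \<epsilon> \<le> dist (\<psi> g) x}" if e: "\<epsilon> > 0" for \<epsilon> :: real
  proof -
    obtain r where r: "\<And>a. a \<in> M \<Longrightarrow> r a > 0 \<and> (\<forall>b\<in>M. d b a < r a \<longrightarrow> dist (\<psi> b) (\<psi> a) < \<epsilon>)"
      using rad[OF _ e] by metis
    obtain P where P: "P \<subseteq> E" "\<not> small P" "\<forall>a\<in>P. \<forall>b\<in>P. d b a < r a"
      using d_ideal_cell[OF I E, of r] r E(1) by blast
    have "small {}" by (rule d_ideal_subset[OF I fibre]) simp
    then have "P \<noteq> {}" using P(2) by metis
    then obtain a where a: "a \<in> P" by blast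
    \<comment> \<open>\<open>P\<close> maps within \<open>\<epsilon>\<close> of
      \<open>\<psi> a\<close>, so the factor 2 leaves a gap of \<open>\<epsilon>\<close> between the
      images of \<open>?F\<close> and \<open>P\<close>.\<close>
    let ?F = "{g \<in> E. 2 * \<epsilon> \<le> dist (\<psi> g) (\<psi> a)}"
    have "\<epsilon> \<le> dist (\<psi> g) (\<psi> b)" if "g \<in> ?F" "b \<in> P" for g b
    proof -
      have "dist (\<psi> b) (\<psi> a) < \<epsilon>" using P a that(2) r[of a] E(1) by blast
      then show ?thesis using that(1) dist_triangle[of "\<psi> g" "\<psi> a" "\<psi> b"] by simp
    qed
    moreover have "?F \<subseteq> E" by auto
    ultimately have "small ?F" using no P(1,2) e by blast
    then show ?thesis by blast
  qed
  then have "\<forall>n. \<exists>x. small {g \<in> E. 2 * (1 / real (Suc n)) \<le> dist (\<psi> g) x}"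
    using zero_less_divide_1_iff of_nat_0_less_iff zero_less_Suc by blast
  then obtain x where x: "\<And>n. small {g \<in> E. 2 * (1 / real (Suc n)) \<le> dist (\<psi> g) (x n)}" by metis
  let ?Q = "{g \<in> E. \<forall>n. dist (\<psi> g) (x n) < 2 * (1 / real (Suc n))}"
  have eq: "\<psi> g = \<psi> h" if "g \<in> ?Q" "h \<in> ?Q" for g h
  proof (rule ccontr)
    assume "\<psi> g \<noteq> \<psi> h"
    then obtain n where n: "1 / real (Suc n) < dist (\<psi> g) (\<psi> h) / 4"
      using reals_Archimedean[of "dist (\<psi> g) (\<psi> h) / 4"] by (auto simp: inverse_eq_divide)
    have "dist (\<psi> g) (x n) < 2 * (1 / real (Suc n))" "dist (\<psi> h) (x n) < 2 * (1 / real (Suc n))"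
      using that by blast+
    then show False using dist_triangle2[of "\<psi> g" "\<psi> h" "x n"] n by linarith
  qed
  have "small ?Q"
  proof (cases "?Q = {}")
    case True
    show ?thesis unfolding True by (rule d_ideal_subset[OF I fibre]) simp
  next
    case False
    then obtain h where "h \<in> ?Q" by blast
    then have "?Q \<subseteq> {a \<in> M. \<psi> a = \<psi> h}" using eq E(1) by blast
    then show ?thesis by (rule d_ideal_subset[OF I fibre])
  qed
  then have "small ((\<Union>n. {g \<in> E. 2 * (1 / real (Suc n)) \<le> dist (\<psi> g) (x n)}) \<union> ?Q)"
    by (intro d_ideal_Un[OF I] d_ideal_UN[OF I] x)
  moreover have "E \<subseteq> (\<Union>n. {g \<in> E. 2 * (1 / real (Suc n)) \<le> dist (\<psi> g) (x n)}) \<union> ?Q"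
    by (auto simp: not_le)
  ultimately show False using E(2) d_ideal_subset[OF I] by blast
qed

text \<open>A Cantor scheme running along the Souslin scheme: each node is split by
  \<open>d_ideal_split\<close> and shrunk by \<open>d_ideal_scheme_cell\<close>. Branch limits exist
  by \<open>analytic_scheme\<close> but are caught only in the closure of \<open>E0\<close>. The gap
  between the images at a splitting node survives in the limit and gives injectivity.\<close>

lemma (in Metric_space) cantor_embedding:
  fixes \<psi> :: "'a \<Rightarrow> 'x::metric_space"
  assumes I: "d_ideal mtopology small" and A: "analytic_scheme A"
    and \<psi>: "continuous_map mtopology euclidean \<psi>"
    and fibre: "\<And>p. small {a \<in> M. \<psi> a = p}"
    and E0: "E0 \<subseteq> M" "\<not> small E0"
  shows "\<exists>c :: (nat \<Rightarrow> bool) \<Rightarrow> 'a. range c \<subseteq> mtopology closure_of E0 \<and> inj (\<psi> \<circ> c) \<and>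
      (\<forall>n \<epsilon> \<epsilon>'. (\<forall>i\<le>n. \<epsilon> i = \<epsilon>' i) \<longrightarrow> d (c \<epsilon>) (c \<epsilon>') \<le> 1 / real (Suc n))"
proof -
  define valid where "valid n p \<longleftrightarrow> fst p \<subseteq> E0 \<and> fst p \<subseteq> A (snd p) \<and> \<not> small (fst p) \<and>
      (n = 0 \<or> (\<forall>a\<in>fst p. \<forall>b\<in>fst p. d a b < 1 / real n))" for n :: nat and p
  define child where "child n p q \<longleftrightarrow> valid (Suc n) q \<and> fst q \<subseteq> fst p \<and> (\<exists>k. snd q = snd p @ [k])"
    for n p q
  have "\<exists>q1 q2. child n p q1 \<and> child n p q2 \<and>
      (\<exists>\<delta>>0. \<forall>a\<in>fst q1. \<forall>b\<in>fst q2. \<delta> \<le> dist (\<psi> a) (\<psi> b))" if "valid n p" for n p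
  proof -
    have p: "fst p \<subseteq> M" "\<not> small (fst p)" using that E0 by (auto simp: valid_def)
    obtain E1 E2 \<delta> where E: "E1 \<subseteq> fst p" "E2 \<subseteq> fst p" "\<not> small E1" "\<not> small E2" "\<delta> > 0"
      "\<forall>a\<in>E1. \<forall>b\<in>E2. \<delta> \<le> dist (\<psi> a) (\<psi> b)"
      using d_ideal_split[OF I \<psi> fibre p] by metis
    have *: "\<exists>q. child n p q \<and> fst q \<subseteq> E" if EE: "E \<subseteq> fst p" "\<not> small E" for E
    proof -
      have "E \<subseteq> A (snd p)" "E \<subseteq> M" using EE p \<open>valid n p\<close> by (auto simp: valid_def)
      moreover have "1 / real (Suc n) > 0" by simp
      ultimately obtain E' k where "E' \<subseteq> E" "E' \<subseteq> A (snd p @ [k])" "\<not> small E'"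
          "\<forall>a\<in>E'. \<forall>b\<in>E'. d a b < 1 / real (Suc n)"
        using d_ideal_scheme_cell[OF I A _ _ EE(2)] by metis
      then show ?thesis using EE(1) \<open>valid n p\<close>
        by (intro exI[of _ "(E', snd p @ [k])"]) (auto simp: child_def valid_def)
    qed
    obtain q1 q2 where "child n p q1" "fst q1 \<subseteq> E1" "child n p q2" "fst q2 \<subseteq> E2"
      using *[OF E(1,3)] *[OF E(2,4)] by blast
    then show ?thesis using E(5,6) by (meson in_mono)
  qed
  then obtain L R where LR: "\<And>n p. valid n p \<Longrightarrow> child n p (L n p) \<and> child n p (R n p) \<and>
      (\<exists>\<delta>>0. \<forall>a\<in>fst (L n p). \<forall>b\<in>fst (R n p). \<delta> \<le> dist (\<psi> a) (\<psi> b))"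
    by metis
  define X where "X = (\<lambda>\<epsilon> :: nat \<Rightarrow> bool. rec_nat (E0, []) (\<lambda>n p. if \<epsilon> n then R n p else L n p))"
  have X0: "X \<epsilon> 0 = (E0, [])" and XS: "X \<epsilon> (Suc n) = (if \<epsilon> n then R n (X \<epsilon> n) else L n (X \<epsilon> n))"
    for \<epsilon> n by (simp_all add: X_def)
  have A0: "E0 \<subseteq> A []" using analytic_scheme_Nil[OF A] E0(1) by simp
  have valid: "valid n (X \<epsilon> n)" for n \<epsilon>
  proof (induction n)
    case 0
    then show ?case using E0 A0 by (simp add: X0 valid_def)
  next
    case (Suc n)
    then show ?case using LR[OF Suc] by (simp add: XS child_def)
  qed
  have child: "child n (X \<epsilon> n) (X \<epsilon> (Suc n))" for n \<epsilon>
    using LR[OF valid] by (simp add: XS)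
  have agree: "X \<epsilon> n = X \<epsilon>' n" if "\<forall>i<n. \<epsilon> i = \<epsilon>' i" for n \<epsilon> \<epsilon>'
    using that by (induction n) (auto simp: X0 XS)
  have mono: "fst (X \<epsilon> n) \<subseteq> fst (X \<epsilon> m)" if "m \<le> n" for m n \<epsilon>
    by (rule lift_Suc_antimono_le[of "\<lambda>n. fst (X \<epsilon> n)", OF _ that])
      (use child in \<open>simp add: child_def\<close>)
  have diam: "d a b < 1 / real (Suc n)" if "a \<in> fst (X \<epsilon> (Suc n))" "b \<in> fst (X \<epsilon> (Suc n))" for a b n \<epsilon>
    using valid[of "Suc n" \<epsilon>] that by (simp add: valid_def)
  have "\<exists>e l. (\<forall>n. e n \<in> fst (X \<epsilon> n)) \<and> limitin mtopology e l sequentially" for \<epsilon>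
  proof -
    have "\<forall>n. \<exists>k. snd (X \<epsilon> (Suc n)) = snd (X \<epsilon> n) @ [k]"
      using child by (simp add: child_def)
    then obtain k where k: "\<And>n. snd (X \<epsilon> (Suc n)) = snd (X \<epsilon> n) @ [k n]" by metis
    have s: "snd (X \<epsilon> n) = map k [0..<n]" for n by (induction n) (simp_all add: X0 k)
    have "small {}" by (rule d_ideal_subset[OF I fibre]) simp
    then have "\<forall>n. \<exists>a. a \<in> fst (X \<epsilon> n)" using valid unfolding valid_def by (metis all_not_in_conv)
    then obtain e where e: "\<And>n. e n \<in> fst (X \<epsilon> n)" by metis
    have "MCauchy e"
      unfolding MCauchy_def
    proof (intro conjI allI impI)
      have "fst (X \<epsilon> n) \<subseteq> M" for n using valid[of n \<epsilon>] E0(1) by (auto simp: valid_def)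
      then show "range e \<subseteq> M" using e by blast
      fix r :: real assume "r > 0"
      then obtain n where n: "1 / real (Suc n) < r" using reals_Archimedean
        by (auto simp: inverse_eq_divide)
      have "d (e i) (e j) < r" if "Suc n \<le> i" "Suc n \<le> j" for i j
        using diam[of "e i" \<epsilon> n "e j"] e mono that n by (meson in_mono less_trans)
      then show "\<exists>N. \<forall>n n'. N \<le> n \<longrightarrow> N \<le> n' \<longrightarrow> d (e n) (e n') < r" by blast
    qed
    moreover have "e n \<in> A (map k [0..<n])" for n
      using e[of n] valid[of n \<epsilon>] s[of n] by (auto simp: valid_def)
    ultimately have "\<exists>l. limitin mtopology e l sequentially"
      using analytic_scheme_limit[OF A] by blast
    then show ?thesis using e by blast
  qed
  then obtain e c where e: "\<And>\<epsilon> n. e \<epsilon> n \<in> fst (X \<epsilon> n)"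
    and c: "\<And>\<epsilon>. limitin mtopology (e \<epsilon>) (c \<epsilon>) sequentially" by metis
  have closure: "c \<epsilon> \<in> mtopology closure_of (fst (X \<epsilon> n))" for \<epsilon> n
  proof (rule limitin_closedin[OF c[of \<epsilon>]])
    have "fst (X \<epsilon> n) \<subseteq> topspace mtopology" using valid[of n \<epsilon>] E0 by (auto simp: valid_def)
    then have "fst (X \<epsilon> n) \<subseteq> mtopology closure_of (fst (X \<epsilon> n))" by (rule closure_of_subset)
    then show "\<forall>\<^sub>F m in sequentially. e \<epsilon> m \<in> mtopology closure_of fst (X \<epsilon> n)"
      using e mono by (intro eventually_sequentiallyI[of n]) blast
  qed simp_all
  have "range c \<subseteq> mtopology closure_of E0" using closure[of _ 0] by (auto simp: X0)
  moreover have "inj (\<psi> \<circ> c)"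
  proof (rule injI, rule ccontr)
    fix \<epsilon> \<epsilon>' assume eq: "(\<psi> \<circ> c) \<epsilon> = (\<psi> \<circ> c) \<epsilon>'" and ne: "\<epsilon> \<noteq> \<epsilon>'"
    define n where "n = (LEAST n. \<epsilon> n \<noteq> \<epsilon>' n)"
    have n: "\<epsilon> n \<noteq> \<epsilon>' n" "\<And>i. i < n \<Longrightarrow> \<epsilon> i = \<epsilon>' i"
      using ne LeastI_ex[of "\<lambda>n. \<epsilon> n \<noteq> \<epsilon>' n"] not_less_Least unfolding n_def by blast+
    have "\<exists>\<delta>>0. \<forall>a\<in>fst (X \<epsilon> (Suc n)). \<forall>b\<in>fst (X \<epsilon>' (Suc n)). \<delta> \<le> dist (\<psi> a) (\<psi> b)"
    proof -
      obtain \<delta> where "\<delta> > 0"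
          "\<forall>a\<in>fst (L n (X \<epsilon> n)). \<forall>b\<in>fst (R n (X \<epsilon> n)). \<delta> \<le> dist (\<psi> a) (\<psi> b)"
        using LR[OF valid[of n \<epsilon>]] by blast
      then have "\<forall>a\<in>fst (X \<epsilon> (Suc n)). \<forall>b\<in>fst (X \<epsilon>' (Suc n)). \<delta> \<le> dist (\<psi> a) (\<psi> b)"
        using agree[of n \<epsilon> \<epsilon>'] n by (cases "\<epsilon> n") (simp_all add: XS, metis dist_commute)
      then show ?thesis using \<open>\<delta> > 0\<close> by blast
    qed
    then obtain \<delta> where \<delta>: "\<delta> > 0"
        "\<And>a b. a \<in> fst (X \<epsilon> (Suc n)) \<Longrightarrow> b \<in> fst (X \<epsilon>' (Suc n)) \<Longrightarrow> \<delta> \<le> dist (\<psi> a) (\<psi> b)" by blast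
    have lim: "(\<lambda>m. \<psi> (e \<epsilon> m)) \<longlonglongrightarrow> \<psi> (c \<epsilon>)" for \<epsilon>
      using continuous_map_limit[OF \<psi> c[of \<epsilon>]] by (simp add: o_def)
    have "(\<lambda>m. dist (\<psi> (e \<epsilon> m)) (\<psi> (e \<epsilon>' m))) \<longlonglongrightarrow> dist (\<psi> (c \<epsilon>)) (\<psi> (c \<epsilon>'))"
      by (intro tendsto_dist lim)
    moreover have "\<delta> \<le> dist (\<psi> (e \<epsilon> m)) (\<psi> (e \<epsilon>' m))" if "Suc n \<le> m" for m
      using \<delta>(2) e mono[OF that] by blast
    ultimately have "\<delta> \<le> dist (\<psi> (c \<epsilon>)) (\<psi> (c \<epsilon>'))"
      by (intro tendsto_lowerbound[where F = sequentially])
         (auto intro: eventually_sequentiallyI[of "Suc n"])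
    then show False using eq \<delta>(1) by simp
  qed
  moreover have "d (c \<epsilon>) (c \<epsilon>') \<le> 1 / real (Suc n)" if "\<forall>i\<le>n. \<epsilon> i = \<epsilon>' i" for n \<epsilon> \<epsilon>'
  proof (rule field_le_epsilon)
    fix r :: real assume r: "r > 0"
    have X: "X \<epsilon>' (Suc n) = X \<epsilon> (Suc n)" using agree[of "Suc n" \<epsilon> \<epsilon>'] that by (simp add: less_Suc_eq_le)
    have near: "\<exists>a. a \<in> fst (X \<epsilon> n) \<and> d (c \<epsilon>) a < r / 2 \<and> c \<epsilon> \<in> M \<and> a \<in> M" for \<epsilon> n
    proof -
      have "\<exists>a\<in>fst (X \<epsilon> n). a \<in> mball (c \<epsilon>) (r / 2)"
        using closure[of \<epsilon> n] half_gt_zero[OF r] unfolding metric_closure_of by blast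
      then show ?thesis by auto
    qed
    obtain a where a: "a \<in> fst (X \<epsilon> (Suc n))" "d (c \<epsilon>) a < r / 2" "c \<epsilon> \<in> M" "a \<in> M"
      using near[of \<epsilon> "Suc n"] by blast
    obtain b where b: "b \<in> fst (X \<epsilon> (Suc n))" "d (c \<epsilon>') b < r / 2" "c \<epsilon>' \<in> M" "b \<in> M"
      using near[of \<epsilon>' "Suc n"] X by auto
    have "d (c \<epsilon>) (c \<epsilon>') \<le> d (c \<epsilon>) a + d a (c \<epsilon>')" "d a (c \<epsilon>') \<le> d a b + d b (c \<epsilon>')"
      using a b by (auto intro: triangle)
    then show "d (c \<epsilon>) (c \<epsilon>') \<le> 1 / real (Suc n) + r"
      using diam[OF a(1) b(1)] a(2) b(2) commute[of b "c \<epsilon>'"] by linarith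
  qed
  ultimately show ?thesis by blast
qed

section \<open>Actions of normed groups\<close>

locale normed_group =
  fixes nm :: "'g::group_add \<Rightarrow> real"
  assumes group_norm: "group_norm nm"
begin

lemma nm_add: "nm (s + t) \<le> nm s + nm t"
  and nm_0 [simp]: "nm 0 = 0"
  and nm_minus [simp]: "nm (- t) = nm t"
  and nm_pos: "t \<noteq> 0 \<Longrightarrow> nm t > 0"
  using group_norm by (auto simp: group_norm_def)

lemma nm_nonneg [simp]: "0 \<le> nm t"
  using nm_pos[of t] by (cases "t = 0") auto

lemma nm_commute: "nm (s - t) = nm (t - s)"
  using nm_minus[of "s - t"] by simp

lemma nm_diff_triangle: "nm (s - u) \<le> nm (s - t) + nm (t - u)"
  using nm_add[of "s - t" "t - u"] by (simp add: algebra_simps)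

sublocale G: Metric_space UNIV "dR nm"
proof
  fix s t u :: 'g
  show "0 \<le> dR nm s t" by (simp add: dR_def)
  show "dR nm s t = dR nm t s" by (simp add: dR_def nm_commute)
  show "dR nm s t = 0 \<longleftrightarrow> s = t"
    using nm_pos[of "s - t"] by (cases "s = t") (auto simp: dR_def)
  show "dR nm s u \<le> dR nm s t + dR nm t u" unfolding dR_def by (rule nm_diff_triangle)
qed

abbreviation TG :: "'g topology" where "TG \<equiv> norm_topology nm"

lemma TG_eq: "TG = G.mtopology" by (simp add: norm_topology_def)

lemma topspace_TG [simp]: "topspace TG = UNIV" by (simp add: TG_eq)

lemma dR_add [simp]: "dR nm (b + t) t = nm b" "dR nm t (b + t) = nm b"
  by (simp_all add: dR_def nm_commute[of t])

lemma openin_TG: "openin TG W \<longleftrightarrow> (\<forall>t\<in>W. \<exists>r>0. \<forall>b. nm b < r \<longrightarrow> b + t \<in> W)"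
proof -
  have "G.mball t r \<subseteq> W \<longleftrightarrow> (\<forall>b. nm b < r \<longrightarrow> b + t \<in> W)" for t r
  proof
    assume *: "\<forall>b. nm b < r \<longrightarrow> b + t \<in> W"
    show "G.mball t r \<subseteq> W"
    proof
      fix x assume "x \<in> G.mball t r"
      then have "nm (x - t) < r" by (simp add: dR_def nm_commute)
      then show "x \<in> W" using *[rule_format, of "x - t"] by simp
    qed
  qed auto
  then show ?thesis by (auto simp: TG_eq G.openin_mtopology)
qed

definition B :: "real \<Rightarrow> 'g set" where "B r = {b. nm b < r}"

lemma B_iff [simp]: "b \<in> B r \<longleftrightarrow> nm b < r" by (simp add: B_def)

lemma openin_B: "openin TG (B r)"
  unfolding openin_TG
proof
  fix t assume "t \<in> B r"
  then show "\<exists>s>0. \<forall>b. nm b < s \<longrightarrow> b + t \<in> B r"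
    by (intro exI[of _ "r - nm t"]) (auto simp: less_diff_eq intro: le_less_trans[OF nm_add])
qed

text \<open>Right translations are isometries of \<open>dR\<close>; left translations need not even
  be continuous.\<close>

lemma homeomorphic_map_right: "homeomorphic_map TG TG (\<lambda>t. t + h)"
proof -
  have cont: "continuous_map TG TG (\<lambda>t. t + k)" for k
    unfolding continuous_map_def
  proof (intro conjI allI impI)
    fix U assume "openin TG U"
    then show "openin TG {x \<in> topspace TG. x + k \<in> U}"
      unfolding openin_TG by (simp add: add.assoc)
  qed simp
  have "homeomorphic_maps TG TG (\<lambda>t. t + h) (\<lambda>t. t + - h)"
    unfolding homeomorphic_maps_def using cont[of h] cont[of "- h"] by (auto simp: add.assoc)
  then show ?thesis by (rule homeomorphic_maps_imp_map)
qed

end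

locale normed_action = normed_group nm for nm :: "'g::group_add \<Rightarrow> real" +
  fixes \<phi> :: "'g \<Rightarrow> 'x::metric_space \<Rightarrow> 'x"
  assumes group_action: "group_action \<phi>"
    and sep: "separately_continuous (norm_topology nm) \<phi>"
begin

lemma act_0 [simp]: "\<phi> 0 x = x"
  and act_add: "\<phi> (g + h) x = \<phi> g (\<phi> h x)"
  using group_action by (auto simp: group_action_def)

lemma act_minus [simp]: "\<phi> (- g) (\<phi> g x) = x" "\<phi> g (\<phi> (- g) x) = x"
  using act_add[of "- g" g x] act_add[of g "- g" x] by simp_all

lemma act_inj: "\<phi> g x = \<phi> g y \<longleftrightarrow> x = y"
  using act_minus(1) by metis

lemma continuous_act: "continuous_on UNIV (\<phi> g)"
  and continuous_orbit: "continuous_map TG euclidean (\<lambda>g. \<phi> g x)"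
  using sep by (auto simp: separately_continuous_def)

lemma homeomorphic_act: "homeomorphic_map euclidean euclidean (\<phi> g)"
proof -
  have "homeomorphic_maps euclidean euclidean (\<phi> g) (\<phi> (- g))"
    using continuous_act[of g] continuous_act[of "- g"] by (auto simp: homeomorphic_maps_def)
  then show ?thesis by (rule homeomorphic_maps_imp_map)
qed

lemma meagre_act_iff: "meagre_in euclidean (\<phi> g ` S) \<longleftrightarrow> meagre_in euclidean S"
proof
  assume "meagre_in euclidean (\<phi> g ` S)"
  from meagre_in_homeomorphic_image[OF homeomorphic_act[of "- g"] this]
  show "meagre_in euclidean S" by (simp add: image_image)
qed (rule meagre_in_homeomorphic_image[OF homeomorphic_act])

lemma open_act: "open U \<Longrightarrow> open (\<phi> g ` U)"
  using homeomorphic_map_openness[OF homeomorphic_act[of g], of U] by simp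

lemma orbit_near:
  assumes "e > 0"
  shows "\<exists>s>0. \<forall>b. nm b < s \<longrightarrow> dist (\<phi> b x) x < e"
proof -
  have "openin TG {g \<in> topspace TG. \<phi> g x \<in> ball x e}"
    by (rule openin_continuous_map_preimage[OF continuous_orbit]) simp
  moreover have "0 \<in> {g \<in> topspace TG. \<phi> g x \<in> ball x e}" using assms by simp
  ultimately have "\<exists>s>0. \<forall>b. nm b < s \<longrightarrow> b + 0 \<in> {g \<in> topspace TG. \<phi> g x \<in> ball x e}"
    unfolding openin_TG by (rule bspec)
  then obtain s where "s > 0" "\<forall>b. nm b < s \<longrightarrow> b + 0 \<in> {g \<in> topspace TG. \<phi> g x \<in> ball x e}"
    by (elim exE conjE)
  then show ?thesis by (intro exI[of _ s]) (simp add: dist_commute)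
qed

lemma orbit_image_add: "(\<lambda>g. \<phi> g x) ` ((\<lambda>b. b + t) ` S) = (\<lambda>b. \<phi> b (\<phi> t x)) ` S"
  by (simp add: image_image act_add)

text \<open>As in Effros' theorem: for \<open>y\<close> close to \<open>x\<close> the orbits of small balls at \<open>x\<close> and at \<open>y\<close> are
  comeagre in a common open set, hence meet.\<close>
lemma micro_transitive_if_comeagre:
  assumes nonm: "\<And>x s. s > 0 \<Longrightarrow> \<not> meagre_in euclidean ((\<lambda>b. \<phi> b x) ` B s)"
    and comeagre: "\<And>x s. s > 0 \<Longrightarrow>
      \<exists>U. open U \<and> U \<noteq> {} \<and> meagre_in euclidean (U - (\<lambda>b. \<phi> b x) ` B s)"
    and r: "r > 0"
  shows "x \<in> interior ((\<lambda>b. \<phi> b x) ` B r)"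
proof -
  \<comment> \<open>Every non-empty open set contains the orbit of a small ball at one of its
    points, so \<open>X\<close> is a Baire space.\<close>
  have baire: "\<not> meagre_in euclidean U" if U: "open U" "U \<noteq> {}" for U :: "'x set"
  proof
    assume m: "meagre_in euclidean U"
    obtain z e where z: "z \<in> U" "e > 0" "ball z e \<subseteq> U" using U by (meson ex_in_conv openE)
    obtain s where s: "s > 0" "\<forall>b. nm b < s \<longrightarrow> dist (\<phi> b z) z < e" using orbit_near z(2) by blast
    then have "(\<lambda>b. \<phi> b z) ` B s \<subseteq> U" using z(3) by (auto simp: dist_commute)
    then show False using nonm[OF s(1)] meagre_in_subset[OF m] by blast
  qed
  \<comment> \<open>Elements of norm below \<open>2 * s\<close> from two orbits are combined into
    one of norm below \<open>4 * s = r\<close>.\<close>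
  define s where "s = r / 4"
  have s: "s > 0" using r by (simp add: s_def)
  \<comment> \<open>Some \<open>w\<close> in \<open>B s\<close> moves \<open>z\<close> into the open
    set \<open>U\<close>. Translating \<open>U\<close> by \<open>- w\<close> yields a neighbourhood
    of \<open>z\<close>, and the extra factor \<open>- w\<close> doubles the radius.\<close>
  have near: "\<exists>N. open N \<and> z \<in> N \<and> meagre_in euclidean (N - (\<lambda>b. \<phi> b z) ` B (2 * s))" for z
  proof -
    obtain U where U: "open U" "U \<noteq> {}" "meagre_in euclidean (U - (\<lambda>b. \<phi> b z) ` B s)"
      using comeagre[OF s] by blast
    have "\<not> U \<subseteq> U - (\<lambda>b. \<phi> b z) ` B s"
      using baire[OF U(1,2)] meagre_in_subset[OF U(3)] by blast
    then obtain w where w: "nm w < s" "\<phi> w z \<in> U" by auto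
    have "meagre_in euclidean (\<phi> (- w) ` (U - (\<lambda>b. \<phi> b z) ` B s))"
      using U(3) by (simp add: meagre_act_iff)
    moreover have "\<phi> (- w) ` U - (\<lambda>b. \<phi> b z) ` B (2 * s) \<subseteq> \<phi> (- w) ` (U - (\<lambda>b. \<phi> b z) ` B s)"
    proof
      fix y assume y: "y \<in> \<phi> (- w) ` U - (\<lambda>b. \<phi> b z) ` B (2 * s)"
      then obtain u where u: "u \<in> U" "y = \<phi> (- w) u" by blast
      have "u \<notin> (\<lambda>b. \<phi> b z) ` B s"
      proof
        assume "u \<in> (\<lambda>b. \<phi> b z) ` B s"
        then obtain b where b: "nm b < s" "u = \<phi> b z" by auto
        have "nm (- w + b) < 2 * s" using nm_add[of "- w" b] b(1) w(1) by simp
        moreover have "y = \<phi> (- w + b) z" using u(2) b(2) by (simp add: act_add)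
        ultimately show False using y by auto
      qed
      then show "y \<in> \<phi> (- w) ` (U - (\<lambda>b. \<phi> b z) ` B s)" using u by blast
    qed
    ultimately have "meagre_in euclidean (\<phi> (- w) ` U - (\<lambda>b. \<phi> b z) ` B (2 * s))"
      by (rule meagre_in_subset)
    moreover have "z \<in> \<phi> (- w) ` U" using imageI[OF w(2), of "\<phi> (- w)"] by simp
    ultimately show ?thesis using open_act[OF U(1)] by blast
  qed
  obtain N where N: "open N" "x \<in> N" "meagre_in euclidean (N - (\<lambda>b. \<phi> b x) ` B (2 * s))"
    using near by blast
  have "N \<subseteq> (\<lambda>b. \<phi> b x) ` B r"
  proof
    fix y assume y: "y \<in> N"
    obtain N' where N': "open N'" "y \<in> N'" "meagre_in euclidean (N' - (\<lambda>b. \<phi> b y) ` B (2 * s))"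
      using near by blast
    have "\<not> meagre_in euclidean (N \<inter> N')" using N N' y by (intro baire) auto
    then have "\<not> N \<inter> N' \<subseteq> (N - (\<lambda>b. \<phi> b x) ` B (2 * s)) \<union> (N' - (\<lambda>b. \<phi> b y) ` B (2 * s))"
      using meagre_in_subset[OF meagre_in_Un[OF N(3) N'(3)]] by blast
    then obtain a b where ab: "nm a < 2 * s" "nm b < 2 * s" "\<phi> a x = \<phi> b y" by fastforce
    have "y = \<phi> (- b + a) x" using ab(3) by (simp add: act_add)
    moreover have "nm (- b + a) < r" using nm_add[of "- b" a] ab s_def by simp
    ultimately show "y \<in> (\<lambda>b. \<phi> b x) ` B r" by auto
  qed
  then show ?thesis using N by (meson interiorI)
qed

lemma comeagre_if_nikodym:
  assumes nik: "nikodym_action TG \<phi>" and s: "s > 0"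
  shows "\<not> meagre_in euclidean ((\<lambda>b. \<phi> b x) ` B s)"
    and "\<exists>U. open U \<and> U \<noteq> {} \<and> meagre_in euclidean (U - (\<lambda>b. \<phi> b x) ` B s)"
proof -
  have "0 \<in> B s" using s by simp
  then obtain A where A: "A \<subseteq> (\<lambda>b. \<phi> b x) ` B s" "\<not> meagre_in euclidean A" "baire_property_in euclidean A"
    using nik openin_B[of s] unfolding nikodym_action_def by blast
  then show "\<not> meagre_in euclidean ((\<lambda>b. \<phi> b x) ` B s)" using meagre_in_subset by blast
  obtain U where U: "open U" "meagre_in euclidean ((A - U) \<union> (U - A))"
    using A(3) by (auto simp: baire_property_in_def)
  have "U \<noteq> {}" using U(2) A(2) by auto
  moreover have "meagre_in euclidean (U - (\<lambda>b. \<phi> b x) ` B s)"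
    by (rule meagre_in_subset[OF U(2)]) (use A(1) in blast)
  ultimately show "\<exists>U. open U \<and> U \<noteq> {} \<and> meagre_in euclidean (U - (\<lambda>b. \<phi> b x) ` B s)"
    using U(1) by blast
qed

end

section \<open>Thin points\<close>

lemma (in Metric_space) discrete_family_separated:
  assumes "r > 0" and sep: "\<And>i j. i \<in> I \<Longrightarrow> j \<in> I \<Longrightarrow> i \<noteq> j \<Longrightarrow> r \<le> d (f i) (f j)"
  shows "discrete_family mtopology ((\<lambda>i. {f i}) ` I)"
  unfolding discrete_family_def
proof
  fix x assume "x \<in> topspace mtopology"
  then have x: "x \<in> M" by simp
  have "i = j" if "i \<in> I" "j \<in> I" "f i \<in> mball x (r/2)" "f j \<in> mball x (r/2)" for i j
  proof (rule ccontr)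
    assume "i \<noteq> j"
    then have "r \<le> d (f i) (f j)" using sep that by blast
    moreover have "d (f i) (f j) \<le> d (f i) x + d x (f j)" using that x by (intro triangle) auto
    ultimately show False using that commute[of x "f i"] by simp
  qed
  then show "\<exists>V. openin mtopology V \<and> x \<in> V \<and>
      (\<forall>E1\<in>(\<lambda>i. {f i}) ` I. \<forall>E2\<in>(\<lambda>i. {f i}) ` I. E1 \<inter> V \<noteq> {} \<and> E2 \<inter> V \<noteq> {} \<longrightarrow> E1 = E2)"
    using x assms(1) by (intro exI[of _ "mball x (r/2)"]) auto
qed

lemma discrete_family_preimage:
  assumes h: "continuous_map T T' h" and \<B>: "discrete_family T' \<B>"
    and Z: "\<And>B g. B \<in> \<B> \<Longrightarrow> g \<in> Z B \<Longrightarrow> h g \<in> B"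
  shows "discrete_family T (Z ` \<B>)"
  unfolding discrete_family_def
proof
  fix x assume x: "x \<in> topspace T"
  then have "h x \<in> topspace T'" using h by (auto simp: continuous_map_def)
  then obtain V where V: "openin T' V" "h x \<in> V"
    "\<forall>E1\<in>\<B>. \<forall>E2\<in>\<B>. E1 \<inter> V \<noteq> {} \<and> E2 \<inter> V \<noteq> {} \<longrightarrow> E1 = E2"
    using \<B> by (auto simp: discrete_family_def)
  show "\<exists>V. openin T V \<and> x \<in> V \<and>
      (\<forall>E1\<in>Z ` \<B>. \<forall>E2\<in>Z ` \<B>. E1 \<inter> V \<noteq> {} \<and> E2 \<inter> V \<noteq> {} \<longrightarrow> E1 = E2)"
  proof (intro exI[of _ "{g \<in> topspace T. h g \<in> V}"] conjI ballI impI)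
    show "openin T {g \<in> topspace T. h g \<in> V}"
      by (rule openin_continuous_map_preimage[OF h V(1)])
    fix E1 E2 assume E: "E1 \<in> Z ` \<B>" "E2 \<in> Z ` \<B>"
      "E1 \<inter> {g \<in> topspace T. h g \<in> V} \<noteq> {} \<and> E2 \<inter> {g \<in> topspace T. h g \<in> V} \<noteq> {}"
    then obtain B1 B2 where B: "B1 \<in> \<B>" "B2 \<in> \<B>" "E1 = Z B1" "E2 = Z B2" by blast
    then obtain g1 g2 where "g1 \<in> Z B1" "h g1 \<in> V" "g2 \<in> Z B2" "h g2 \<in> V" using E(3) by blast
    then have "B1 \<inter> V \<noteq> {} \<and> B2 \<inter> V \<noteq> {}" using Z B(1,2) by blast
    then show "E1 = E2" using V(3) B by metis
  qed (use x V in auto)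
qed

lemma discrete_family_compact:
  fixes K :: "'a::topological_space set"
  assumes \<B>: "discrete_family euclidean \<B>" and K: "compact K"
  shows "finite {B \<in> \<B>. B \<inter> K \<noteq> {}}"
proof -
  have "\<forall>x. \<exists>V. open V \<and> x \<in> V \<and>
      (\<forall>E1\<in>\<B>. \<forall>E2\<in>\<B>. E1 \<inter> V \<noteq> {} \<and> E2 \<inter> V \<noteq> {} \<longrightarrow> E1 = E2)"
    using \<B> by (simp add: discrete_family_def)
  then obtain V where V: "\<And>x. open (V x)" "\<And>x. x \<in> V x"
    "\<And>x E1 E2. E1 \<in> \<B> \<Longrightarrow> E2 \<in> \<B> \<Longrightarrow> E1 \<inter> V x \<noteq> {} \<Longrightarrow> E2 \<inter> V x \<noteq> {} \<Longrightarrow> E1 = E2"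
    by metis
  obtain C where C: "C \<subseteq> K" "finite C" "K \<subseteq> (\<Union>c\<in>C. V c)"
    by (rule compactE_image[OF K, of K V]) (use V(1,2) in auto)
  have "finite {B \<in> \<B>. B \<inter> V c \<noteq> {}}" for c
  proof (cases "{B \<in> \<B>. B \<inter> V c \<noteq> {}} = {}")
    case False
    then obtain B0 where "B0 \<in> \<B>" "B0 \<inter> V c \<noteq> {}" by blast
    then have "{B \<in> \<B>. B \<inter> V c \<noteq> {}} \<subseteq> {B0}" using V(3) by blast
    then show ?thesis using finite_subset by blast
  next
    case True
    then show ?thesis by (metis finite.emptyI)
  qed
  then have "finite (\<Union>c\<in>C. {B \<in> \<B>. B \<inter> V c \<noteq> {}})" using C(2) by blast
  moreover have "{B \<in> \<B>. B \<inter> K \<noteq> {}} \<subseteq> (\<Union>c\<in>C. {B \<in> \<B>. B \<inter> V c \<noteq> {}})" using C(3) by blast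
  ultimately show ?thesis by (rule finite_subset[rotated])
qed

lemma base_sigma_discreteD:
  assumes "base_sigma_discrete TX TY f" "discrete_family TX \<E>"
  shows "\<exists>F :: nat \<Rightarrow> 'b set set. (\<forall>n. discrete_family TY (F n)) \<and>
    (\<forall>E\<in>\<E>. f ` E = \<Union>{B \<in> \<Union>(range F). B \<subseteq> f ` E})"
proof -
  obtain \<B> where "sigma_discrete TY \<B>" and base: "base_for \<B> ((\<lambda>E. f ` E) ` \<E>)"
    using assms unfolding base_sigma_discrete_def by blast
  then obtain F where "\<B> = \<Union>(range F)" and disc: "\<forall>n::nat. discrete_family TY (F n)"
    unfolding sigma_discrete_def by blast
  have "f ` E = \<Union>{B \<in> \<Union>(range F). B \<subseteq> f ` E}" if E: "E \<in> \<E>" for E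
  proof -
    obtain \<C> where C: "\<C> \<subseteq> \<B>" "f ` E = \<Union>\<C>"
      using base E unfolding base_for_def by blast
    have "\<C> \<subseteq> {B \<in> \<Union>(range F). B \<subseteq> f ` E}"
      using C(1) Union_upper[of _ \<C>] unfolding C(2) \<open>\<B> = _\<close> by auto
    then have "f ` E \<subseteq> \<Union>{B \<in> \<Union>(range F). B \<subseteq> f ` E}" using C(2) by (metis Union_mono)
    then show ?thesis by (intro equalityI) auto
  qed
  then show ?thesis using disc by (intro exI[of _ F]) simp
qed

text \<open>Cardinals are comparable. If \<open>P\<close> is the smaller set, \<open>A\<close> is
  cut down to a copy of it; this still gives distinct points of \<open>P\<close> to uncountably many
  indices.\<close>

lemma uncountable_inj_on:
  assumes "uncountable A" "uncountable P"
  obtains A' j where "A' \<subseteq> A" "uncountable A'" "inj_on j A'" "j ` A' \<subseteq> P"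
proof -
  have "(\<exists>j. inj_on j A \<and> j ` A \<subseteq> P) \<or> (\<exists>h. inj_on h P \<and> h ` P \<subseteq> A)"
    unfolding card_of_ordLeq using ordLeq_total[OF card_of_Well_order card_of_Well_order] by blast
  then show ?thesis
  proof
    assume "\<exists>j. inj_on j A \<and> j ` A \<subseteq> P"
    then show ?thesis using that[of A] assms(1) by blast
  next
    assume "\<exists>h. inj_on h P \<and> h ` P \<subseteq> A"
    then obtain h where h: "inj_on h P" "h ` P \<subseteq> A" by blast
    have "uncountable (h ` P)" using assms(2) h(1) countable_image_inj_on by blast
    then show ?thesis
      using that[of "h ` P" "the_inv_into P h"] h
      by (simp add: inj_on_the_inv_into image_image the_inv_into_f_f)
  qed
qed

text \<open>The analytic case without isolated points: \<open>perfect\<close> makes singletons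
  meagre, so that the fibres of an evaluation are small for the ideal of meagre orbit
  images.\<close>

locale analytic_action = normed_action nm \<phi>
  for nm :: "'g::group_add \<Rightarrow> real" and \<phi> :: "'g \<Rightarrow> 'x::metric_space \<Rightarrow> 'x" +
  fixes A :: "nat list \<Rightarrow> 'g set"
  assumes scheme: "G.analytic_scheme A"
    and bsd: "base_sigma_discrete TG euclidean (\<lambda>g. \<phi> g x)"
    and trans: "transitive_action \<phi>"
    and baireG: "Baire_space_top TG"
    and nonmeagreX: "\<not> meagre_in euclidean (UNIV :: 'x set)"
    and perfect: "\<not> open {x :: 'x}"
begin

lemma transitiveE: obtains g where "\<phi> g x = y"
  using trans by (auto simp: transitive_action_def)

lemma meagre_singleton: "meagre_in euclidean {x :: 'x}"
proof -
  have "interior {x} = {}" using interior_subset[of "{x}"] open_interior[of "{x}"] perfect[of x]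
    by (metis subset_singletonD)
  then show ?thesis
    by (intro nowhere_dense_imp_meagre) (simp add: nowhere_dense_in_def)
qed

text \<open>The images of the members need not be discrete, but they are unions of members of a
  sigma-discrete base. Each base member kept in \<open>?F\<close> lies in one meagre image, and
  discrete unions of meagre sets in \<open>X\<close> are meagre.\<close>

lemma d_ideal_orbit_meagre: "d_ideal TG (\<lambda>E. meagre_in euclidean ((\<lambda>g. \<phi> g x) ` E))"
proof (rule d_idealI)
  show "meagre_in euclidean ((\<lambda>g. \<phi> g x) ` F)"
    if "meagre_in euclidean ((\<lambda>g. \<phi> g x) ` E)" "F \<subseteq> E" for E F
    using that by (meson image_mono meagre_in_subset)
  show "meagre_in euclidean ((\<lambda>g. \<phi> g x) ` (\<Union>n. F n))"
    if "\<And>n. meagre_in euclidean ((\<lambda>g. \<phi> g x) ` F n)" for F :: "nat \<Rightarrow> 'g set"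
    unfolding image_UN using that by (intro meagre_in_UN) auto
  fix \<E> assume E: "discrete_family TG \<E>"
    "\<And>E. E \<in> \<E> \<Longrightarrow> meagre_in euclidean ((\<lambda>g. \<phi> g x) ` E)"
  from base_sigma_discreteD[OF bsd[of x] E(1)]
  obtain F where F': "\<forall>n::nat. discrete_family euclidean (F n)"
    "\<forall>E\<in>\<E>. (\<lambda>g. \<phi> g x) ` E = \<Union>{B \<in> \<Union>(range F). B \<subseteq> (\<lambda>g. \<phi> g x) ` E}"
    by (elim exE conjE) (rule that; assumption)
  note F = F'[rule_format]
  let ?F = "\<lambda>n. {B \<in> F n. \<exists>E\<in>\<E>. B \<subseteq> (\<lambda>g. \<phi> g x) ` E}"
  have "meagre_in euclidean (\<Union>(?F n))" for n
  proof (rule meagre_in_discrete_Union)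
    show "discrete_family euclidean (?F n)" by (rule discrete_family_mono[OF F(1)[of n]]) blast
    fix B assume "B \<in> ?F n"
    then obtain E' where "E' \<in> \<E>" "B \<subseteq> (\<lambda>g. \<phi> g x) ` E'" by blast
    then show "meagre_in euclidean B" using E(2) by (blast intro: meagre_in_subset)
  qed
  then have "meagre_in euclidean (\<Union>n. \<Union>(?F n))" by (intro meagre_in_UN) auto
  moreover have "(\<lambda>g. \<phi> g x) ` \<Union>\<E> \<subseteq> (\<Union>n. \<Union>(?F n))"
  proof
    fix y assume "y \<in> (\<lambda>g. \<phi> g x) ` \<Union>\<E>"
    then obtain E' where "E' \<in> \<E>" "y \<in> (\<lambda>g. \<phi> g x) ` E'" by blast
    then have "y \<in> \<Union>{B \<in> \<Union>(range F). B \<subseteq> (\<lambda>g. \<phi> g x) ` E'}" using F(2) by metis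
    then show "y \<in> (\<Union>n. \<Union>(?F n))" using \<open>E' \<in> \<E>\<close> by blast
  qed
  ultimately show "meagre_in euclidean ((\<lambda>g. \<phi> g x) ` \<Union>\<E>)" by (rule meagre_in_subset)
qed

text \<open>The compact set \<open>K\<close> meets only finitely many members of each discrete level
  of the base, so countability on \<open>K\<close> survives a discrete union.\<close>

lemma d_ideal_orbit_countable:
  assumes K: "compact K"
  shows "d_ideal TG (\<lambda>E. countable ((\<lambda>g. \<phi> g x) ` E \<inter> K))"
proof (rule d_idealI)
  show "countable ((\<lambda>g. \<phi> g x) ` F \<inter> K)"
    if "countable ((\<lambda>g. \<phi> g x) ` E \<inter> K)" "F \<subseteq> E" for E F
    using that(1) by (rule countable_subset[rotated]) (use that(2) in blast)
  show "countable ((\<lambda>g. \<phi> g x) ` (\<Union>n. F n) \<inter> K)"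
    if "\<And>n. countable ((\<lambda>g. \<phi> g x) ` F n \<inter> K)" for F :: "nat \<Rightarrow> 'g set"
  proof -
    have "countable (\<Union>n. (\<lambda>g. \<phi> g x) ` F n \<inter> K)" by (intro countable_UN that) simp
    then show ?thesis by (rule countable_subset[rotated]) blast
  qed
  fix \<E> assume E: "discrete_family TG \<E>" "\<And>E. E \<in> \<E> \<Longrightarrow> countable ((\<lambda>g. \<phi> g x) ` E \<inter> K)"
  from base_sigma_discreteD[OF bsd[of x] E(1)]
  obtain F where F': "\<forall>n::nat. discrete_family euclidean (F n)"
    "\<forall>E\<in>\<E>. (\<lambda>g. \<phi> g x) ` E = \<Union>{B \<in> \<Union>(range F). B \<subseteq> (\<lambda>g. \<phi> g x) ` E}"
    by (elim exE conjE) (rule that; assumption)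
  note F = F'[rule_format]
  let ?F = "\<lambda>n. {B \<in> F n. B \<inter> K \<noteq> {} \<and> (\<exists>E\<in>\<E>. B \<subseteq> (\<lambda>g. \<phi> g x) ` E)}"
  have fin: "finite (?F n)" for n
    by (rule finite_subset[OF _ discrete_family_compact[OF F(1)[of n] K]]) blast
  have "countable (B \<inter> K)" if B: "B \<in> ?F n" for n B
  proof -
    obtain E' where E': "E' \<in> \<E>" "B \<subseteq> (\<lambda>g. \<phi> g x) ` E'" using B by blast
    then have "B \<inter> K \<subseteq> (\<lambda>g. \<phi> g x) ` E' \<inter> K" by blast
    then show ?thesis using E(2)[OF E'(1)] by (rule countable_subset)
  qed
  then have "countable (\<Union>n. \<Union>B\<in>?F n. B \<inter> K)"
  proof (intro countable_UN)
    show "countable (?F n)" for n using fin by (rule countable_finite)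
  qed simp_all
  moreover have "(\<lambda>g. \<phi> g x) ` \<Union>\<E> \<inter> K \<subseteq> (\<Union>n. \<Union>B\<in>?F n. B \<inter> K)"
  proof
    fix y assume y: "y \<in> (\<lambda>g. \<phi> g x) ` \<Union>\<E> \<inter> K"
    then obtain E' where "E' \<in> \<E>" "y \<in> (\<lambda>g. \<phi> g x) ` E'" by blast
    then have "y \<in> \<Union>{B \<in> \<Union>(range F). B \<subseteq> (\<lambda>g. \<phi> g x) ` E'}" using F(2) by metis
    then show "y \<in> (\<Union>n. \<Union>B\<in>?F n. B \<inter> K)" using \<open>E' \<in> \<E>\<close> y by blast
  qed
  ultimately show "countable ((\<lambda>g. \<phi> g x) ` \<Union>\<E> \<inter> K)" by (rule countable_subset[rotated])
qed

text \<open>At a point \<open>p\<close> that is not thin, only countably many members of a discrete family can send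
  \<open>z\<close> to \<open>p\<close>: representatives of uncountably many could be moved slightly, keeping them separated,
  to have uncountably many distinct images in a compact set. This makes discrete unions of meagre
  sets tractable near \<open>p\<close>.\<close>
definition thin :: "'x \<Rightarrow> bool" where
  "thin x \<longleftrightarrow> (\<exists>s>0. \<forall>K. compact K \<longrightarrow> countable ((\<lambda>b. \<phi> b x) ` B s \<inter> K))"

lemma mball_orbit: "(\<lambda>g. \<phi> g x) ` G.mball a r = (\<lambda>b. \<phi> b (\<phi> a x)) ` B r"
proof -
  have "G.mball a r = (\<lambda>b. b + a) ` B r"
  proof
    show "G.mball a r \<subseteq> (\<lambda>b. b + a) ` B r"
    proof
      fix g assume "g \<in> G.mball a r"
      then have "g - a \<in> B r" by (simp add: dR_def nm_commute)
      then have "g - a + a \<in> (\<lambda>b. b + a) ` B r" by (rule imageI)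
      then show "g \<in> (\<lambda>b. b + a) ` B r" by simp
    qed
  qed auto
  then show ?thesis by (simp add: orbit_image_add)
qed

text \<open>Take the thinness radii as \<open>r\<close> in \<open>d_ideal_cell\<close>. The
  resulting set has an uncountable orbit image in \<open>K\<close> but lies in one ball
  \<open>G.mball a (r a)\<close>, whose orbit is that of \<open>B (r a)\<close> at the thin point
  \<open>\<phi> a z\<close> and so is countable on \<open>K\<close>.\<close>

lemma countable_thin_compact:
  assumes K: "compact K"
  shows "countable (Collect thin \<inter> K)"
proof (rule ccontr)
  assume unc: "uncountable (Collect thin \<inter> K)"
  fix z :: 'x
  let ?E = "{g. thin (\<phi> g z)}"
  have "Collect thin \<inter> K \<subseteq> (\<lambda>g. \<phi> g z) ` ?E \<inter> K"
  proof
    fix y assume y: "y \<in> Collect thin \<inter> K"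
    obtain g where "\<phi> g z = y" by (rule transitiveE)
    then show "y \<in> (\<lambda>g. \<phi> g z) ` ?E \<inter> K" using y by blast
  qed
  then have unc': "uncountable ((\<lambda>g. \<phi> g z) ` ?E \<inter> K)" using unc countable_subset by blast
  have "\<forall>a\<in>?E. \<exists>r>0. countable ((\<lambda>b. \<phi> b (\<phi> a z)) ` B r \<inter> K)"
    using K unfolding thin_def by blast
  from bchoice[OF this] obtain r where
    r': "\<forall>a\<in>?E. r a > 0 \<and> countable ((\<lambda>b. \<phi> b (\<phi> a z)) ` B (r a) \<inter> K)" by (elim exE)
  then have r: "\<And>a. a \<in> ?E \<Longrightarrow> r a > 0"
    "\<And>a. a \<in> ?E \<Longrightarrow> countable ((\<lambda>b. \<phi> b (\<phi> a z)) ` B (r a) \<inter> K)" by simp_all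
  have "\<exists>E'\<subseteq>?E. uncountable ((\<lambda>g. \<phi> g z) ` E' \<inter> K) \<and>
      (\<forall>a\<in>E'. \<forall>b\<in>E'. dR nm b a < r a)"
    by (rule G.d_ideal_cell[OF d_ideal_orbit_countable[OF K, of z, unfolded TG_eq] subset_UNIV unc'])
       (rule r(1))
  then obtain E' where E': "E' \<subseteq> ?E" "uncountable ((\<lambda>g. \<phi> g z) ` E' \<inter> K)"
      "\<forall>a\<in>E'. \<forall>b\<in>E'. dR nm b a < r a"
    by (elim exE conjE) (rule that; assumption)
  then have "E' \<noteq> {}" by (intro notI) simp
  then obtain a where a: "a \<in> E'" by blast
  have "E' \<subseteq> G.mball a (r a)"
    using E'(3) a by (auto simp: G.commute[of a])
  then have "(\<lambda>g. \<phi> g z) ` E' \<inter> K \<subseteq> (\<lambda>b. \<phi> b (\<phi> a z)) ` B (r a) \<inter> K"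
    using mball_orbit[of z a "r a"] by blast
  moreover have "countable ((\<lambda>b. \<phi> b (\<phi> a z)) ` B (r a) \<inter> K)"
    using r(2)[of a] a E'(1) by blast
  ultimately show False using E'(2) countable_subset by blast
qed

lemma countable_members_at_not_thin:
  assumes p: "\<not> thin p" and \<E>: "discrete_family TG \<E>"
  shows "countable {E \<in> \<E>. p \<in> (\<lambda>g. \<phi> g z) ` E}"
proof (rule ccontr)
  let ?C = "{E \<in> \<E>. p \<in> (\<lambda>g. \<phi> g z) ` E}"
  assume unc: "uncountable ?C"
  have "\<forall>E\<in>?C. \<exists>e. e \<in> E \<and> \<phi> e z = p" by blast
  then obtain e where e: "\<And>E. E \<in> ?C \<Longrightarrow> e E \<in> E \<and> \<phi> (e E) z = p" by metis
  \<comment> \<open>Each representative has a ball missing all other members. Uncountably many of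
    them share one \<open>n\<close>, and these are \<open>r\<close>-separated.\<close>
  have "\<exists>n. \<forall>E'\<in>\<E>. E' \<noteq> E \<longrightarrow> E' \<inter> G.mball (e E) (1 / real (Suc n)) = {}" if E: "E \<in> ?C" for E
  proof -
    have "e E \<in> topspace TG" by simp
    from bspec[OF \<E>[unfolded discrete_family_def] this] obtain V where V: "openin TG V" "e E \<in> V"
      "\<forall>E1\<in>\<E>. \<forall>E2\<in>\<E>. E1 \<inter> V \<noteq> {} \<and> E2 \<inter> V \<noteq> {} \<longrightarrow> E1 = E2"
      by (elim exE conjE)
    obtain r where r: "r > 0" "G.mball (e E) r \<subseteq> V"
      using V(1,2) unfolding TG_eq G.openin_mtopology by blast
    obtain n where "1 / real (Suc n) < r" using reals_Archimedean[OF r(1)]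
      by (auto simp: inverse_eq_divide)
    then have "G.mball (e E) (1 / real (Suc n)) \<subseteq> V" using r(2) by auto
    moreover have "E \<inter> V \<noteq> {}" "E \<in> \<E>" using e[OF E] V(2) E by auto
    ultimately have "\<forall>E'\<in>\<E>. E' \<noteq> E \<longrightarrow> E' \<inter> G.mball (e E) (1 / real (Suc n)) = {}"
      using V(3) by blast
    then show ?thesis by blast
  qed
  then have "\<forall>E\<in>?C. \<exists>n. \<forall>E'\<in>\<E>. E' \<noteq> E \<longrightarrow> E' \<inter> G.mball (e E) (1 / real (Suc n)) = {}" by blast
  from bchoice[OF this] obtain m where m': "\<forall>E\<in>?C. \<forall>E'\<in>\<E>. E' \<noteq> E \<longrightarrow>
      E' \<inter> G.mball (e E) (1 / real (Suc (m E))) = {}" by (elim exE)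
  then have m: "E' \<inter> G.mball (e E) (1 / real (Suc (m E))) = {}"
    if "E \<in> ?C" "E' \<in> \<E>" "E' \<noteq> E" for E E' using that by blast
  have "?C = (\<Union>n. {E \<in> ?C. m E = n})" by auto
  then obtain n where n: "uncountable {E \<in> ?C. m E = n}"
    using unc countable_UN[of UNIV "\<lambda>n. {E \<in> ?C. m E = n}"] by auto
  define r where "r = 1 / real (Suc n)"
  have r: "r > 0" by (simp add: r_def)
  have sep: "r \<le> dR nm (e E) (e E')" if "E \<in> ?C" "m E = n" "E' \<in> ?C" "E \<noteq> E'" for E E'
  proof -
    have "e E' \<notin> G.mball (e E) r"
      using m[OF that(1), of E'] that e[OF that(3)] unfolding r_def by auto
    then show ?thesis by simp
  qed
  \<comment> \<open>Moving two \<open>r\<close>-separated elements by less than \<open>r/3\<close>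
    each leaves them at least \<open>r/3\<close> apart.\<close>
  obtain K where K: "compact K" "uncountable ((\<lambda>b. \<phi> b p) ` B (r/3) \<inter> K)"
    using p r unfolding thin_def by (meson divide_pos_pos zero_less_numeral)
  obtain C' j where C': "C' \<subseteq> {E \<in> ?C. m E = n}" "uncountable C'" "inj_on j C'"
      "j ` C' \<subseteq> (\<lambda>b. \<phi> b p) ` B (r/3) \<inter> K"
    by (rule uncountable_inj_on[OF n K(2)])
  have "\<forall>E\<in>C'. \<exists>b. nm b < r/3 \<and> j E = \<phi> b p"
  proof
    fix E assume "E \<in> C'"
    then have "j E \<in> (\<lambda>b. \<phi> b p) ` B (r/3)" using C'(4) by blast
    then show "\<exists>b. nm b < r/3 \<and> j E = \<phi> b p" by auto
  qed
  then obtain b where b: "\<And>E. E \<in> C' \<Longrightarrow> nm (b E) < r/3 \<and> j E = \<phi> (b E) p" by metis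
  have "r/3 \<le> dR nm (b E + e E) (b E' + e E')" if E: "E \<in> C'" "E' \<in> C'" "E \<noteq> E'" for E E'
  proof -
    have "E \<in> {E \<in> ?C. m E = n}" "E' \<in> {E \<in> ?C. m E = n}" using E(1,2) C'(1) by blast+
    then have "r \<le> dR nm (e E) (e E')" using sep[of E E'] E(3) by simp
    also have "\<dots> \<le> dR nm (e E) (b E + e E) + dR nm (b E + e E) (e E')"
      by (rule G.triangle) auto
    also have "dR nm (b E + e E) (e E') \<le>
        dR nm (b E + e E) (b E' + e E') + dR nm (b E' + e E') (e E')"
      by (rule G.triangle) auto
    finally have "r \<le> nm (b E) + (dR nm (b E + e E) (b E' + e E') + nm (b E'))" by simp
    then show ?thesis using b[OF E(1)] b[OF E(2)] by linarith
  qed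
  then have "discrete_family TG ((\<lambda>E. {b E + e E}) ` C')"
    unfolding TG_eq using r by (intro G.discrete_family_separated[of "r/3"]) auto
  from base_sigma_discreteD[OF bsd[of z] this]
  obtain F where F': "\<forall>n::nat. discrete_family euclidean (F n)"
    "\<forall>D\<in>(\<lambda>E. {b E + e E}) ` C'.
      (\<lambda>g. \<phi> g z) ` D = \<Union>{B \<in> \<Union>(range F). B \<subseteq> (\<lambda>g. \<phi> g z) ` D}"
    by (elim exE conjE) (rule that; assumption)
  note F = F'[rule_format]
  \<comment> \<open>A base member that contains \<open>j E\<close> and lies in \<open>{j E}\<close>
    is \<open>{j E}\<close> itself. So uncountably many singletons would occur among the countably
    many base members that meet \<open>K\<close>.\<close>
  have "(\<lambda>E. {j E}) ` C' \<subseteq> (\<Union>n. {B \<in> F n. B \<inter> K \<noteq> {}})"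
  proof
    fix D assume "D \<in> (\<lambda>E. {j E}) ` C'"
    then obtain E where E: "E \<in> C'" "D = {j E}" by blast
    have "E \<in> ?C" using E(1) C'(1) by blast
    then have "\<phi> (b E + e E) z = j E" using b[OF E(1)] e by (simp add: act_add)
    then have im: "(\<lambda>g. \<phi> g z) ` {b E + e E} = {j E}" by simp
    have "\<Union>{B \<in> \<Union>(range F). B \<subseteq> {j E}} = {j E}"
      using F(2)[OF imageI[OF E(1)]] unfolding im by (rule sym)
    then have "j E \<in> \<Union>{B \<in> \<Union>(range F). B \<subseteq> {j E}}" by (rule equalityD2[THEN subsetD]) simp
    then obtain B' where "B' \<in> \<Union>(range F)" "B' \<subseteq> {j E}" "j E \<in> B'" by blast
    then have "D \<in> \<Union>(range F)" using E(2) by (metis subset_singletonD empty_iff)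
    moreover have "j E \<in> K" using C'(4) E(1) by blast
    ultimately show "D \<in> (\<Union>n. {B \<in> F n. B \<inter> K \<noteq> {}})" using E(2) by blast
  qed
  moreover have "countable (\<Union>n. {B \<in> F n. B \<inter> K \<noteq> {}})"
    by (intro countable_UN countable_finite[OF discrete_family_compact[OF F(1) K(1)]]) simp
  ultimately have "countable ((\<lambda>E. {j E}) ` C')" by (rule countable_subset)
  moreover have "inj_on (\<lambda>E. {j E}) C'" using C'(3) by (auto simp: inj_on_def)
  ultimately show False using C'(2) countable_image_inj_on by blast
qed

text \<open>Stated through the action because the conjugate of \<open>b\<close> by \<open>f\<close> is only controlled modulo the
  elements that fix every point.\<close>
definition conj_continuous :: "'g \<Rightarrow> bool" where
  "conj_continuous f \<longleftrightarrow>
     (\<forall>s>0. \<exists>\<delta>>0. \<forall>b. nm b < \<delta> \<longrightarrow> (\<exists>a. nm a < s \<and> (\<forall>x. \<phi> (f + b) x = \<phi> (a + f) x)))"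

text \<open>The images of a discrete family at \<open>z\<close> are broken into members
  \<open>C\<close> of a sigma-discrete base, and these are pulled back along \<open>g\<close> to
  \<open>\<phi> (f + g) z\<close>. \<open>Z C\<close> also records that \<open>f + g\<close> lies in
  a member whose image contains \<open>C\<close>. At a point that is not thin there are only
  countably many such members, so \<open>Z C\<close> is meagre.\<close>

lemma d_ideal_translate_meagre:
  assumes V: "\<And>g. g \<in> V \<Longrightarrow> \<not> thin (\<phi> (f + g) z)"
  shows "d_ideal TG (\<lambda>E. meagre_in TG {g \<in> V. f + g \<in> E})"
proof (rule d_idealI)
  show "meagre_in TG {g \<in> V. f + g \<in> F}"
    if "meagre_in TG {g \<in> V. f + g \<in> E}" "F \<subseteq> E" for E F
    using that(1) by (rule meagre_in_subset) (use that(2) in blast)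
  show "meagre_in TG {g \<in> V. f + g \<in> (\<Union>n. F n)}"
    if F: "\<And>n. meagre_in TG {g \<in> V. f + g \<in> F n}" for F :: "nat \<Rightarrow> 'g set"
  proof -
    have "meagre_in TG (\<Union>n. {g \<in> V. f + g \<in> F n})" by (intro meagre_in_UN F) simp
    then show ?thesis by (rule meagre_in_subset) blast
  qed
  fix \<E> assume \<E>: "discrete_family TG \<E>" "\<And>E. E \<in> \<E> \<Longrightarrow> meagre_in TG {g \<in> V. f + g \<in> E}"
  from base_sigma_discreteD[OF bsd[of z] \<E>(1)]
  obtain F where F': "\<forall>n::nat. discrete_family euclidean (F n)"
    "\<forall>E\<in>\<E>. (\<lambda>g. \<phi> g z) ` E = \<Union>{B \<in> \<Union>(range F). B \<subseteq> (\<lambda>g. \<phi> g z) ` E}"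
    by (elim exE conjE) (rule that; assumption)
  note F = F'[rule_format]
  define Z where "Z C = {g \<in> V. \<phi> (f + g) z \<in> C \<and> (\<exists>E\<in>\<E>. C \<subseteq> (\<lambda>g. \<phi> g z) ` E \<and> f + g \<in> E)}" for C
  have "continuous_map TG euclidean (\<phi> f \<circ> (\<lambda>g. \<phi> g z))"
    using continuous_orbit continuous_act by (intro continuous_map_compose) auto
  then have cont: "continuous_map TG euclidean (\<lambda>g. \<phi> (f + g) z)" by (simp add: o_def act_add)
  have "meagre_in TG (Z C)" for C
  proof (cases "Z C = {}")
    case True
    then show ?thesis by (simp add: meagre_in_empty)
  next
    case False
    then obtain g where g: "g \<in> V" "\<phi> (f + g) z \<in> C" by (auto simp: Z_def)
    have "countable {E \<in> \<E>. \<phi> (f + g) z \<in> (\<lambda>g. \<phi> g z) ` E}"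
      by (rule countable_members_at_not_thin[OF V[OF g(1)] \<E>(1)])
    then have "countable {E \<in> \<E>. C \<subseteq> (\<lambda>g. \<phi> g z) ` E}"
      by (rule countable_subset[rotated]) (use g(2) in blast)
    then have "meagre_in TG (\<Union>E\<in>{E \<in> \<E>. C \<subseteq> (\<lambda>g. \<phi> g z) ` E}. {g \<in> V. f + g \<in> E})"
      by (rule meagre_in_UN) (use \<E>(2) in blast)
    then show ?thesis by (rule meagre_in_subset) (auto simp: Z_def)
  qed
  moreover have "discrete_family TG (Z ` F n)" for n
    by (rule discrete_family_preimage[OF cont F(1)]) (simp add: Z_def)
  ultimately have Zm: "meagre_in TG (\<Union>(Z ` F n))" for n
    by (intro meagre_in_discrete_Union) auto
  have "meagre_in TG (\<Union>n. \<Union>(Z ` F n))" by (rule meagre_in_UN) (simp, rule Zm)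
  moreover have "{g \<in> V. f + g \<in> \<Union>\<E>} \<subseteq> (\<Union>n. \<Union>(Z ` F n))"
  proof
    fix g assume g: "g \<in> {g \<in> V. f + g \<in> \<Union>\<E>}"
    then obtain E where E: "E \<in> \<E>" "f + g \<in> E" by blast
    then have "\<phi> (f + g) z \<in> (\<lambda>g. \<phi> g z) ` E" by blast
    then have "\<phi> (f + g) z \<in> \<Union>{B \<in> \<Union>(range F). B \<subseteq> (\<lambda>g. \<phi> g z) ` E}"
      by (rule equalityD1[OF F(2)[OF E(1)], THEN subsetD])
    then obtain n C where "C \<in> F n" "C \<subseteq> (\<lambda>g. \<phi> g z) ` E" "\<phi> (f + g) z \<in> C" by blast
    then show "g \<in> (\<Union>n. \<Union>(Z ` F n))" using E g by (auto simp: Z_def)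
  qed
  ultimately show "meagre_in TG {g \<in> V. f + g \<in> \<Union>\<E>}" by (rule meagre_in_subset)
qed

text \<open>An automatic continuity argument. Left translation by \<open>f\<close> sends a
  non-meagre part of \<open>V\<close> into a set \<open>E\<close> of small diameter. By
  \<open>comeagre_limits\<close>, for comeagre many \<open>t\<close> in some open \<open>U\<close>
  the element \<open>f + t\<close> acts like one close to \<open>E\<close>, and every small
  \<open>k\<close> is composed of four such \<open>t\<close> and their inverses.\<close>

lemma conj_continuous_if_not_thin:
  assumes V: "openin TG V" "V \<noteq> {}" "\<And>g. g \<in> V \<Longrightarrow> \<not> thin (\<phi> (f + g) z)"
  shows "conj_continuous f"
  unfolding conj_continuous_def
proof (intro allI impI)
  fix s :: real assume s: "s > 0"
  let ?small = "\<lambda>E. meagre_in TG {g \<in> V. f + g \<in> E}"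
  have I: "d_ideal G.mtopology ?small" using d_ideal_translate_meagre[OF V(3)] by (simp add: TG_eq)
  have "\<not> ?small UNIV" using baireG V(1,2) by (simp add: Baire_space_top_def)
  \<comment> \<open>Three elements within \<open>s / 5\<close> of one point of \<open>E\<close> give
    two differences of norm at most \<open>2 * s / 5\<close>, with sum below
    \<open>s\<close>.\<close>
  then have "\<exists>E'\<subseteq>UNIV. \<not> ?small E' \<and> (\<forall>a\<in>E'. \<forall>b\<in>E'. dR nm b a < s / 5)"
    by (intro G.d_ideal_cell[OF I]) (use s in auto)
  then obtain E where E: "\<not> ?small E" "\<And>a b. a \<in> E \<Longrightarrow> b \<in> E \<Longrightarrow> dR nm b a < s / 5" by blast
  define E0 where "E0 = E \<inter> (\<lambda>g. f + g) ` V"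
  have im: "(\<lambda>e. - f + e) ` D = {g \<in> V. f + g \<in> D}" if "D \<subseteq> (\<lambda>g. f + g) ` V" for D
  proof
    show "{g \<in> V. f + g \<in> D} \<subseteq> (\<lambda>e. - f + e) ` D"
    proof
      fix g assume "g \<in> {g \<in> V. f + g \<in> D}"
      then have "- f + (f + g) \<in> (\<lambda>e. - f + e) ` D" by blast
      then show "g \<in> (\<lambda>e. - f + e) ` D" by (simp add: add.assoc[symmetric])
    qed
    show "(\<lambda>e. - f + e) ` D \<subseteq> {g \<in> V. f + g \<in> D}"
      using that by (auto simp: add.assoc[symmetric])
  qed
  let ?good = "\<lambda>t. \<exists>e l. (\<forall>n. e n \<in> E0) \<and> limitin TG e l sequentially \<and>
      limitin TG (\<lambda>n. - f + e n) t sequentially"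
  have "\<exists>U. openin TG U \<and> U \<noteq> {} \<and> meagre_in TG (U - {t. ?good t})"
    unfolding TG_eq
  proof (rule G.comeagre_limits[OF G.Metric_space_axioms scheme])
    show "\<not> meagre_in G.mtopology ((\<lambda>e. - f + e) ` E0)"
    proof -
      have "{g \<in> V. f + g \<in> E0} = {g \<in> V. f + g \<in> E}" by (auto simp: E0_def)
      then show ?thesis using im[of E0] E(1) by (simp add: E0_def TG_eq)
    qed
    fix \<E> assume \<E>: "discrete_family G.mtopology \<E>"
      "\<And>D. D \<in> \<E> \<Longrightarrow> D \<subseteq> E0 \<and> meagre_in G.mtopology ((\<lambda>e. - f + e) ` D)"
    have sub: "D \<subseteq> (\<lambda>g. f + g) ` V" if "D \<in> \<E>" for D using \<E>(2)[OF that] by (auto simp: E0_def)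
    have "?small D" if "D \<in> \<E>" for D
      using \<E>(2)[OF that] im[OF sub[OF that]] by (simp add: TG_eq)
    then have "?small (\<Union>\<E>)" by (rule d_ideal_Union[OF I \<E>(1)])
    moreover have "\<Union>\<E> \<subseteq> (\<lambda>g. f + g) ` V" using sub by blast
    ultimately show "meagre_in G.mtopology ((\<lambda>e. - f + e) ` \<Union>\<E>)" using im by (simp add: TG_eq)
  qed simp_all
  then obtain U where U: "openin TG U" "U \<noteq> {}" "meagre_in TG (U - {t. ?good t})" by blast
  \<comment> \<open>Without continuity of left translation \<open>l\<close> need not equal
    \<open>f + t\<close>, but for every \<open>x\<close> both send it to the limit of
    \<open>\<phi> (e n) x\<close>. This is where the kernel enters.\<close>
  have lim_eq: "\<phi> (f + t) x = \<phi> l x"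
    if lim: "limitin TG e l sequentially" "limitin TG (\<lambda>n. - f + e n) t sequentially" for e l t x
  proof -
    have "(\<lambda>n. \<phi> (e n) x) \<longlonglongrightarrow> \<phi> l x"
      using continuous_map_limit[OF continuous_orbit lim(1)] by (simp add: o_def)
    moreover have "(\<lambda>n. \<phi> (- f + e n) x) \<longlonglongrightarrow> \<phi> t x"
      using continuous_map_limit[OF continuous_orbit lim(2)] by (simp add: o_def)
    then have "(\<lambda>n. \<phi> f (\<phi> (- f + e n) x)) \<longlonglongrightarrow> \<phi> f (\<phi> t x)"
      by (rule continuous_on_tendsto_compose[OF continuous_act]) auto
    then have "(\<lambda>n. \<phi> (e n) x) \<longlonglongrightarrow> \<phi> (f + t) x" by (simp add: act_add)
    ultimately show ?thesis by (metis LIMSEQ_unique)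
  qed
  have good: "\<exists>l. (\<forall>x. \<phi> (f + t) x = \<phi> l x) \<and> (\<forall>a\<in>E. dR nm l a \<le> s / 5)" if gt: "?good t" for t
  proof -
    obtain e l where e: "\<And>n. e n \<in> E0" "limitin TG e l sequentially"
        "limitin TG (\<lambda>n. - f + e n) t sequentially" using gt by blast
    have "dR nm l a \<le> s / 5" if a: "a \<in> E" for a
    proof -
      have "l \<in> G.mcball a (s / 5)"
      proof (rule limitin_closedin[OF e(2)])
        have "e n \<in> G.mcball a (s / 5)" for n
          using E(2)[of "e n" a] e(1)[of n] a by (auto simp: E0_def intro: less_imp_le)
        then show "\<forall>\<^sub>F n in sequentially. e n \<in> G.mcball a (s / 5)"
          by (intro always_eventually) blast
      qed (simp_all add: TG_eq)
      then show ?thesis by (simp add: G.commute)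
    qed
    then show ?thesis using lim_eq[OF e(2,3)] by blast
  qed
  have "\<not> meagre_in TG U" using baireG U(1,2) by (simp add: Baire_space_top_def)
  then obtain t0 where t0: "t0 \<in> U" "?good t0"
    using meagre_in_subset[OF U(3), of U] by blast
  obtain \<delta> where \<delta>: "\<delta> > 0" "\<And>b. nm b < \<delta> \<Longrightarrow> b + t0 \<in> U"
    using U(1) t0(1) unfolding openin_TG by blast
  have "\<exists>a. nm a < s \<and> (\<forall>x. \<phi> (f + k) x = \<phi> (a + f) x)" if k: "nm k < \<delta>" for k
  proof -
    \<comment> \<open>Since \<open>k + t0 = t0 + h\<close>, the left shift of \<open>t0\<close> by
      \<open>k\<close> becomes a right translation, which preserves meagre sets. This provides good
      \<open>t\<close> and \<open>t1\<close> with \<open>t = t1 + h\<close>.\<close>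
    define h where "h = - t0 + k + t0"
    let ?R = "\<lambda>t. t + h"
    have "openin TG (?R ` U)"
      using homeomorphic_map_openness[OF homeomorphic_map_right, of U h] U(1) by simp
    moreover have "k + t0 = ?R t0" by (simp add: h_def add.assoc[symmetric])
    then have "k + t0 \<in> U \<inter> ?R ` U" using \<delta>(2)[OF k] t0(1) by auto
    ultimately have "\<not> meagre_in TG (U \<inter> ?R ` U)"
      using baireG U(1) unfolding Baire_space_top_def by (metis empty_iff openin_Int)
    moreover have "meagre_in TG (?R ` (U - {t. ?good t}))"
      by (rule meagre_in_homeomorphic_image[OF homeomorphic_map_right U(3)])
    ultimately have "\<not> U \<inter> ?R ` U \<subseteq> (U - {t. ?good t}) \<union> ?R ` (U - {t. ?good t})"
      using meagre_in_subset[OF meagre_in_Un[OF U(3)]] by blast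
    then obtain t t1 where t: "?good t" "t = t1 + h" "?good t1" by blast
    obtain l0 where l0: "\<And>x. \<phi> (f + t0) x = \<phi> l0 x" "\<And>a. a \<in> E \<Longrightarrow> dR nm l0 a \<le> s / 5"
      using good[OF t0(2)] by blast
    obtain l1 where l1: "\<And>x. \<phi> (f + t1) x = \<phi> l1 x" "\<And>a. a \<in> E \<Longrightarrow> dR nm l1 a \<le> s / 5"
      using good[OF t(3)] by blast
    obtain l where l: "\<And>x. \<phi> (f + t) x = \<phi> l x" "\<And>a. a \<in> E \<Longrightarrow> dR nm l a \<le> s / 5"
      using good[OF t(1)] by blast
    have "E \<noteq> {}" using E(1) meagre_in_empty by fastforce
    then obtain a where a: "a \<in> E" by blast
    have "dR nm l0 l1 \<le> dR nm l0 a + dR nm a l1" "dR nm l l0 \<le> dR nm l a + dR nm a l0"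
      by (simp_all add: G.triangle)
    then have "nm (l0 - l1) + nm (l - l0) < s"
      using l0(2)[OF a] l1(2)[OF a] l(2)[OF a] G.commute[of a l1] G.commute[of a l0] s
      by (simp add: dR_def)
    then have small: "nm (l0 - l1 + (l - l0)) < s" using nm_add[of "l0 - l1" "l - l0"] by linarith
    have inv: "\<phi> (- u) y = \<phi> (- m) (\<phi> f y)" if "\<And>x. \<phi> (f + u) x = \<phi> m x" for u m y
      using that[of "\<phi> (- u) y"] by (simp add: act_add)
    have fwd: "\<phi> f (\<phi> t y) = \<phi> l y" for y using l(1)[of y] by (simp add: act_add)
    have "\<phi> (f + k) x = \<phi> ((l0 - l1 + (l - l0)) + f) x" for x
    proof -
      \<comment> \<open>Inserting \<open>- f\<close> and \<open>f\<close> between these factors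
        turns \<open>f + k\<close> into \<open>l0 - l1 + (l - l0)\<close> acting after
        \<open>f\<close>.\<close>
      have "t0 + (- t1 + (t + (- t0))) = k"
        unfolding t(2) h_def by (simp add: add.assoc del: add_uminus_conv_diff)
      then have "\<phi> (f + k) x = \<phi> (f + t0) (\<phi> (- t1) (\<phi> t (\<phi> (- t0) x)))"
        by (metis act_add)
      also have "\<dots> = \<phi> l0 (\<phi> (- l1) (\<phi> l (\<phi> (- l0) (\<phi> f x))))"
        by (simp add: l0(1) inv[OF l1(1)] inv[OF l0(1)] fwd)
      also have "\<dots> = \<phi> ((l0 - l1 + (l - l0)) + f) x"
        by (simp add: act_add diff_conv_add_uminus del: add_uminus_conv_diff)
      finally show ?thesis .
    qed
    then show ?thesis using small by blast
  qed
  then show "\<exists>\<delta>>0. \<forall>b. nm b < \<delta> \<longrightarrow> (\<exists>a. nm a < s \<and> (\<forall>x. \<phi> (f + b) x = \<phi> (a + f) x))"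
    using \<delta>(1) by blast
qed

end

section \<open>The Cantor space\<close>

lemma topology_nat_bool:
  shows compact_UNIV_nat_bool: "compact (UNIV :: (nat \<Rightarrow> bool) set)"
    and regular_nat_bool: "regular_space (euclidean :: (nat \<Rightarrow> bool) topology)"
proof -
  have compact: "compact_space (euclidean :: bool topology)"
    by (simp add: compact_space_def finite_imp_compact)
  have Hausdorff: "Hausdorff_space (euclidean :: bool topology)"
    unfolding Hausdorff_space_def
  proof clarify
    fix x y :: bool assume "x \<noteq> y"
    then show "\<exists>U V. openin euclidean U \<and> openin euclidean V \<and> x \<in> U \<and> y \<in> V \<and> disjnt U V"
      by (intro exI[of _ "{x}"] exI[of _ "{y}"]) (simp add: open_discrete)
  qed
  have "compact_space (product_topology (\<lambda>i::nat. euclidean :: bool topology) UNIV)"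
    "Hausdorff_space (product_topology (\<lambda>i::nat. euclidean :: bool topology) UNIV)"
    using compact Hausdorff by (simp_all add: compact_space_product_topology Hausdorff_space_product_topology)
  then have c: "compact_space (euclidean :: (nat \<Rightarrow> bool) topology)"
    "Hausdorff_space (euclidean :: (nat \<Rightarrow> bool) topology)"
    by (simp_all only: euclidean_product_topology)
  then show "compact (UNIV :: (nat \<Rightarrow> bool) set)" by (simp add: compact_space_def)
  show "regular_space (euclidean :: (nat \<Rightarrow> bool) topology)"
    using c by (simp add: compact_Hausdorff_imp_regular_space)
qed

definition cylinder :: "bool list \<Rightarrow> (nat \<Rightarrow> bool) set" where
  "cylinder l = {\<epsilon>. \<forall>i<length l. \<epsilon> i = l ! i}"

lemma open_cylinder: "open (cylinder l)"
proof -
  have "cylinder l = (\<Inter>i<length l. (\<lambda>\<epsilon>. \<epsilon> i) -` {l ! i})" by (auto simp: cylinder_def)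
  moreover have "open ((\<lambda>\<epsilon> :: nat \<Rightarrow> bool. \<epsilon> i) -` {l ! i})" for i
    by (rule open_vimage[OF open_discrete]) (rule continuous_on_product_coordinates)
  ultimately show ?thesis by (simp add: open_INT)
qed

lemma cylinder_prefix: "\<epsilon>' \<in> cylinder (map \<epsilon> [0..<n]) \<longleftrightarrow> (\<forall>i<n. \<epsilon>' i = \<epsilon> i)"
  by (simp add: cylinder_def)

lemma open_contains_cylinder:
  assumes "open U" "\<epsilon> \<in> U"
  shows "\<exists>n. cylinder (map \<epsilon> [0..<n]) \<subseteq> U"
proof -
  have "openin (product_topology (\<lambda>i::nat. euclidean :: bool topology) UNIV) U"
    using assms(1) by (simp add: euclidean_product_topology)
  from product_topology_open_contains_basis[OF this assms(2)] obtain X where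
    X: "\<epsilon> \<in> (\<Pi>\<^sub>E i\<in>UNIV. X i)" "finite {i. X i \<noteq> UNIV}" "(\<Pi>\<^sub>E i\<in>UNIV. X i) \<subseteq> U"
    by auto
  obtain n where n: "\<And>i. X i \<noteq> UNIV \<Longrightarrow> i < n"
    using finite_nat_bounded[OF X(2)] by blast
  have "cylinder (map \<epsilon> [0..<n]) \<subseteq> (\<Pi>\<^sub>E i\<in>UNIV. X i)"
  proof
    fix \<epsilon>' assume e: "\<epsilon>' \<in> cylinder (map \<epsilon> [0..<n])"
    have "\<epsilon>' i \<in> X i" for i
    proof (cases "X i = UNIV")
      case False
      then have "\<epsilon>' i = \<epsilon> i" using e n[of i] by (simp add: cylinder_prefix)
      then show ?thesis using X(1) by auto
    qed simp
    then show "\<epsilon>' \<in> (\<Pi>\<^sub>E i\<in>UNIV. X i)" by auto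
  qed
  then show ?thesis using X(3) by blast
qed

lemma not_open_singleton_nat_bool: "\<not> open {\<epsilon> :: nat \<Rightarrow> bool}"
proof
  assume "open {\<epsilon>}"
  then obtain n where n: "cylinder (map \<epsilon> [0..<n]) \<subseteq> {\<epsilon>}"
    using open_contains_cylinder by blast
  have "\<epsilon>(n := \<not> \<epsilon> n) \<in> cylinder (map \<epsilon> [0..<n])" by (simp add: cylinder_prefix)
  then have "\<epsilon>(n := \<not> \<epsilon> n) = \<epsilon>" using n by blast
  then show False by (metis fun_upd_same)
qed

text \<open>Singletons are closed with empty interior in the Cantor space, so the countably many
  exceptional points can join the closed cover before the Baire theorem is applied.\<close>

lemma cantor_Baire:
  assumes "countable \<G>" "\<And>T. T \<in> \<G> \<Longrightarrow> closed T" "countable C" "UNIV \<subseteq> C \<union> \<Union>\<G>"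
  shows "\<exists>T\<in>\<G>. \<exists>l. cylinder l \<noteq> {} \<and> cylinder l \<subseteq> (T :: (nat \<Rightarrow> bool) set)"
proof (rule ccontr)
  assume no: "\<not> ?thesis"
  let ?\<H> = "\<G> \<union> (\<lambda>c. {c}) ` C"
  have "interior T = {}" if T: "T \<in> \<G>" for T
  proof (rule ccontr)
    assume "interior T \<noteq> {}"
    then obtain \<epsilon> where "\<epsilon> \<in> interior T" by blast
    then obtain n where n: "cylinder (map \<epsilon> [0..<n]) \<subseteq> interior T"
      using open_contains_cylinder open_interior by blast
    then have "cylinder (map \<epsilon> [0..<n]) \<subseteq> T" using interior_subset by blast
    moreover have "\<epsilon> \<in> cylinder (map \<epsilon> [0..<n])" by (simp add: cylinder_prefix)
    ultimately show False using no T by blast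
  qed
  moreover have "interior {c} = {}" for c :: "nat \<Rightarrow> bool"
    using interior_subset[of "{c}"] open_interior[of "{c}"] not_open_singleton_nat_bool[of c]
    by (metis subset_singletonD)
  moreover have "closed {c}" for c :: "nat \<Rightarrow> bool"
  proof -
    have "open (- {c})"
      unfolding open_subopen[of "- {c}"]
    proof
      fix \<epsilon> assume "\<epsilon> \<in> - {c}"
      then obtain i where "\<epsilon> i \<noteq> c i" by auto
      then have "cylinder (map \<epsilon> [0..<Suc i]) \<subseteq> - {c}"
        by (auto simp: cylinder_prefix simp del: upt_Suc)
      moreover have "\<epsilon> \<in> cylinder (map \<epsilon> [0..<Suc i])" by (simp add: cylinder_prefix del: upt_Suc)
      ultimately show "\<exists>T. open T \<and> \<epsilon> \<in> T \<and> T \<subseteq> - {c}" using open_cylinder by blast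
    qed
    then show ?thesis by (simp add: closed_def)
  qed
  ultimately have *: "closedin euclidean T \<and> euclidean interior_of T = {}" if "T \<in> ?\<H>" for T
    using that assms(2) by auto
  have "compact_space (euclidean :: (nat \<Rightarrow> bool) topology)"
    using compact_UNIV_nat_bool by (simp add: compact_space_def)
  then have "locally_compact_space (euclidean :: (nat \<Rightarrow> bool) topology)"
    by (rule compact_imp_locally_compact_space)
  then have "euclidean interior_of \<Union>?\<H> = {}"
    using regular_nat_bool assms(1,3) * by (intro Baire_category_alt) auto
  moreover have "\<Union>?\<H> = UNIV" using assms(4) by auto
  ultimately show False by simp
qed

lemma uncountable_UNIV_nat_bool: "uncountable (UNIV :: (nat \<Rightarrow> bool) set)"
proof
  assume "countable (UNIV :: (nat \<Rightarrow> bool) set)"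
  then obtain f :: "nat \<Rightarrow> nat \<Rightarrow> bool" where f: "range f = UNIV"
    by (metis UNIV_not_empty range_from_nat_into)
  then obtain n where "f n = (\<lambda>n. \<not> f n n)" by (metis UNIV_I imageE)
  then show False by metis
qed

section \<open>There are no thin points\<close>

context analytic_action
begin

text \<open>Inversion need not be continuous in the group. For the second map \<open>- c \<epsilon>'
  = - c \<epsilon> + (c \<epsilon> - c \<epsilon>')\<close> helps: a small element acts first, the
  fixed homeomorphism \<open>\<phi> (- c \<epsilon>)\<close> afterwards.\<close>

lemma cantor_continuous:
  fixes c :: "(nat \<Rightarrow> bool) \<Rightarrow> 'g"
  assumes c: "\<And>n \<epsilon> \<epsilon>'. (\<forall>i\<le>n. \<epsilon> i = \<epsilon>' i) \<Longrightarrow> dR nm (c \<epsilon>) (c \<epsilon>') \<le> 1 / real (Suc n)"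
  shows "continuous_on UNIV (\<lambda>\<epsilon>. \<phi> (c \<epsilon>) u)" and "continuous_on UNIV (\<lambda>\<epsilon>. \<phi> (- c \<epsilon>) u)"
proof -
  have near: "\<exists>S. open S \<and> \<epsilon> \<in> S \<and> (\<forall>\<epsilon>'\<in>S. nm (c \<epsilon>' - c \<epsilon>) < r)" if r: "r > 0" for \<epsilon> r
  proof -
    obtain n where n: "1 / real (Suc n) < r" using reals_Archimedean[OF r]
      by (auto simp: inverse_eq_divide)
    have "nm (c \<epsilon>' - c \<epsilon>) < r" if "\<epsilon>' \<in> cylinder (map \<epsilon> [0..<Suc n])" for \<epsilon>'
      using c[of n \<epsilon>' \<epsilon>] that n by (simp add: cylinder_prefix dR_def less_Suc_eq_le del: upt_Suc)
    moreover have "\<epsilon> \<in> cylinder (map \<epsilon> [0..<Suc n])" by (simp add: cylinder_prefix del: upt_Suc)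
    ultimately show ?thesis using open_cylinder by blast
  qed
  show "continuous_on UNIV (\<lambda>\<epsilon>. \<phi> (c \<epsilon>) u)"
    unfolding continuous_on_topological
  proof (intro ballI allI impI)
    fix \<epsilon> U assume U: "open U" "\<phi> (c \<epsilon>) u \<in> U"
    obtain e where e: "e > 0" "ball (\<phi> (c \<epsilon>) u) e \<subseteq> U" using U openE by blast
    obtain s where s: "s > 0" "\<And>b. nm b < s \<Longrightarrow> dist (\<phi> b (\<phi> (c \<epsilon>) u)) (\<phi> (c \<epsilon>) u) < e"
      using orbit_near[OF e(1)] by blast
    obtain S where S: "open S" "\<epsilon> \<in> S" "\<forall>\<epsilon>'\<in>S. nm (c \<epsilon>' - c \<epsilon>) < s" using near[OF s(1)] by blast
    have "\<phi> (c \<epsilon>') u \<in> U" if "\<epsilon>' \<in> S" for \<epsilon>'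
    proof -
      have "\<phi> (c \<epsilon>') u = \<phi> (c \<epsilon>' - c \<epsilon>) (\<phi> (c \<epsilon>) u)" by (simp flip: act_add)
      then show ?thesis using s(2)[of "c \<epsilon>' - c \<epsilon>"] S(3) that e(2) by (auto simp: dist_commute)
    qed
    then show "\<exists>A. open A \<and> \<epsilon> \<in> A \<and> (\<forall>y\<in>UNIV. y \<in> A \<longrightarrow> \<phi> (c y) u \<in> U)" using S by blast
  qed
  show "continuous_on UNIV (\<lambda>\<epsilon>. \<phi> (- c \<epsilon>) u)"
    unfolding continuous_on_topological
  proof (intro ballI allI impI)
    fix \<epsilon> U assume U: "open U" "\<phi> (- c \<epsilon>) u \<in> U"
    have "open (\<phi> (- c \<epsilon>) -` U)" by (rule open_vimage[OF U(1) continuous_act])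
    then obtain e where e: "e > 0" "ball u e \<subseteq> \<phi> (- c \<epsilon>) -` U" using U(2) openE by blast
    obtain s where s: "s > 0" "\<And>b. nm b < s \<Longrightarrow> dist (\<phi> b u) u < e"
      using orbit_near[OF e(1)] by blast
    obtain S where S: "open S" "\<epsilon> \<in> S" "\<forall>\<epsilon>'\<in>S. nm (c \<epsilon>' - c \<epsilon>) < s" using near[OF s(1)] by blast
    have "\<phi> (- c \<epsilon>') u \<in> U" if "\<epsilon>' \<in> S" for \<epsilon>'
    proof -
      have "nm (c \<epsilon> - c \<epsilon>') < s" using S(3) that nm_commute by metis
      then have "\<phi> (c \<epsilon> - c \<epsilon>') u \<in> ball u e" using s(2) by (simp add: dist_commute)
      then have "\<phi> (- c \<epsilon>) (\<phi> (c \<epsilon> - c \<epsilon>') u) \<in> U" using e(2) by blast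
      moreover have "- c \<epsilon> + (c \<epsilon> - c \<epsilon>') = - c \<epsilon>'"
        by (simp only: diff_conv_add_uminus minus_add_cancel)
      ultimately show ?thesis by (metis act_add)
    qed
    then show "\<exists>A. open A \<and> \<epsilon> \<in> A \<and> (\<forall>y\<in>UNIV. y \<in> A \<longrightarrow> \<phi> (- c y) u \<in> U)" using S by blast
  qed
qed

lemma thin_if_fixed:
  assumes "\<delta> > 0" "\<And>b. nm b < \<delta> \<Longrightarrow> \<phi> b x = x"
  shows "thin x"
proof -
  have "(\<lambda>b. \<phi> b x) ` B \<delta> \<inter> K \<subseteq> {x}" for K using assms(2) by auto
  then have "countable ((\<lambda>b. \<phi> b x) ` B \<delta> \<inter> K)" for K by (rule countable_subset) simp
  then show ?thesis using assms(1) unfolding thin_def by blast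
qed

text \<open>If small elements fix \<open>w\<close>, then for each \<open>f\<close> one of \<open>\<phi> f w\<close>, \<open>\<phi> (- f) w\<close> is thin. On a
  Cantor set \<open>c\<close> of group elements this splits the square into a relation with countable sections and
  its converse. As in Sierpinski's paradox this needs the continuum hypothesis, but here the
  relation is definable enough for a Baire category argument to refute it outright.\<close>
lemma not_fixed_by_ball:
  assumes \<epsilon>: "\<epsilon> > 0" and w: "\<And>b. nm b < \<epsilon> \<Longrightarrow> \<phi> b w = w"
  shows False
proof -
  \<comment> \<open>If \<open>\<phi> (- f) w\<close> is not thin, conjugation by \<open>- f\<close>
    turns small \<open>b\<close> into elements that act like small \<open>a\<close>, which fix
    \<open>w\<close>. Hence small \<open>b\<close> fix \<open>\<phi> f w\<close>, and a point fixed
    by a ball is thin.\<close>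
  have either: "thin (\<phi> f w)" if f: "\<not> thin (\<phi> (- f) w)" for f
  proof -
    have "conj_continuous (- f)"
    proof (rule conj_continuous_if_not_thin[OF openin_B])
      show "B \<epsilon> \<noteq> {}" using \<epsilon> by (metis B_iff empty_iff nm_0)
      show "\<not> thin (\<phi> (- f + g) w)" if "g \<in> B \<epsilon>" for g using f that w by (simp add: act_add)
    qed
    then obtain \<delta> where \<delta>: "\<delta> > 0"
        "\<And>b. nm b < \<delta> \<Longrightarrow> \<exists>a. nm a < \<epsilon> \<and> (\<forall>x. \<phi> (- f + b) x = \<phi> (a + - f) x)"
      using \<epsilon> unfolding conj_continuous_def by blast
    have "\<phi> b (\<phi> f w) = \<phi> f w" if b: "nm b < \<delta>" for b
    proof -
      obtain a where a: "nm a < \<epsilon>" "\<phi> (- f + b) (\<phi> f w) = \<phi> (a + - f) (\<phi> f w)"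
        using \<delta>(2)[OF b] by blast
      then have "\<phi> (- f) (\<phi> b (\<phi> f w)) = \<phi> a w" by (simp only: act_add act_minus)
      then have "\<phi> (- f) (\<phi> b (\<phi> f w)) = w" using w[OF a(1)] by simp
      then show ?thesis by (metis act_minus(2))
    qed
    then show ?thesis by (rule thin_if_fixed[OF \<delta>(1)])
  qed
  let ?small = "\<lambda>E. meagre_in euclidean ((\<lambda>g. \<phi> g w) ` E)"
  have "\<exists>c :: (nat \<Rightarrow> bool) \<Rightarrow> 'g. range c \<subseteq> G.mtopology closure_of UNIV \<and> inj ((\<lambda>g. \<phi> g w) \<circ> c) \<and>
      (\<forall>n \<epsilon> \<epsilon>'. (\<forall>i\<le>n. \<epsilon> i = \<epsilon>' i) \<longrightarrow> dR nm (c \<epsilon>) (c \<epsilon>') \<le> 1 / real (Suc n))"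
  proof (rule G.cantor_embedding[OF _ scheme])
    show "d_ideal G.mtopology ?small" using d_ideal_orbit_meagre by (simp add: TG_eq)
    show "continuous_map G.mtopology euclidean (\<lambda>g. \<phi> g w)"
      using continuous_orbit by (simp add: TG_eq)
    show "?small {a \<in> UNIV. \<phi> a w = p}" for p
      by (rule meagre_in_subset[OF meagre_singleton[of p]]) blast
    have "(\<lambda>g. \<phi> g w) ` UNIV = UNIV" using transitiveE by (metis surjI)
    then show "\<not> ?small UNIV" using nonmeagreX by simp
  qed simp
  then obtain c :: "(nat \<Rightarrow> bool) \<Rightarrow> 'g" where inj: "inj (\<lambda>\<epsilon>. \<phi> (c \<epsilon>) w)"
    and c: "\<And>n \<epsilon> \<epsilon>'. (\<forall>i\<le>n. \<epsilon> i = \<epsilon>' i) \<Longrightarrow> dR nm (c \<epsilon>) (c \<epsilon>') \<le> 1 / real (Suc n)"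
    by (auto simp: o_def)
  note cont = cantor_continuous[OF c]
  \<comment> \<open>The values determine \<open>x\<close>, and their compact range contains only
    countably many thin points.\<close>
  have few: "countable {x. thin (\<phi> (- c y + c x) w)}" for y
  proof -
    let ?h = "\<lambda>x. \<phi> (- c y + c x) w"
    have "continuous_on UNIV (\<lambda>x. \<phi> (- c y) (\<phi> (c x) w))"
      by (rule continuous_on_compose2[OF continuous_act cont(1) subset_UNIV])
    then have "compact (range ?h)"
      by (intro compact_continuous_image[OF _ compact_UNIV_nat_bool]) (simp add: act_add)
    then have "countable (Collect thin \<inter> range ?h)" by (rule countable_thin_compact)
    then have "countable (?h ` {x. thin (?h x)})" by (rule countable_subset[rotated]) blast
    moreover have "inj_on ?h {x. thin (?h x)}"
      using inj by (auto simp: inj_on_def act_add act_inj)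
    ultimately show ?thesis by (rule countable_image_inj_on)
  qed
  \<comment> \<open>In the other variable \<open>either\<close> and \<open>few\<close> make the
    value thin off a countable set. The compact range has only countably many thin values, so one of
    them is taken on a whole cylinder.\<close>
  have cyl: "\<exists>l. cylinder l \<noteq> {} \<and> (\<exists>\<theta>. thin \<theta> \<and> (\<forall>y\<in>cylinder l. \<phi> (- c y + c x) w = \<theta>))" for x
  proof -
    let ?k = "\<lambda>y. \<phi> (- c y + c x) w"
    let ?T = "Collect thin \<inter> range ?k"
    have "continuous_on UNIV (\<lambda>y. \<phi> (- c y) (\<phi> (c x) w))" by (rule cont(2))
    then have k: "continuous_on UNIV ?k" by (simp add: act_add)
    have "countable ?T"
      by (rule countable_thin_compact) (rule compact_continuous_image[OF k compact_UNIV_nat_bool])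
    then have "countable ((\<lambda>\<theta>. ?k -` {\<theta>}) ` ?T)" by (rule countable_image)
    moreover have "closed T" if "T \<in> (\<lambda>\<theta>. ?k -` {\<theta>}) ` ?T" for T
      using that closed_vimage[OF closed_singleton k] by blast
    moreover have "UNIV \<subseteq> {y. \<not> thin (?k y)} \<union> \<Union>((\<lambda>\<theta>. ?k -` {\<theta>}) ` ?T)" by auto
    moreover have "countable {y. \<not> thin (?k y)}"
    proof (rule countable_subset[OF _ few[of x]])
      show "{y. \<not> thin (?k y)} \<subseteq> {y. thin (\<phi> (- c x + c y) w)}"
      proof
        fix y assume "y \<in> {y. \<not> thin (?k y)}"
        then have "\<not> thin (\<phi> (- (- c x + c y)) w)" by (simp add: minus_add)
        then show "y \<in> {y. thin (\<phi> (- c x + c y) w)}" using either by blast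
      qed
    qed
    ultimately obtain T l where T: "T \<in> (\<lambda>\<theta>. ?k -` {\<theta>}) ` ?T" "cylinder l \<noteq> {}" "cylinder l \<subseteq> T"
      using cantor_Baire[of "(\<lambda>\<theta>. ?k -` {\<theta>}) ` ?T" "{y. \<not> thin (?k y)}"] by blast
    then obtain \<theta> where "thin \<theta>" "T = ?k -` {\<theta>}" by blast
    then show ?thesis using T(2,3) by (intro exI[of _ l] conjI exI[of _ \<theta>]) auto
  qed
  \<comment> \<open>There are countably many cylinders, and each serves countably many
    \<open>x\<close>, because any \<open>y\<close> in it puts \<open>x\<close> into the countable
    section at \<open>y\<close>. Yet every \<open>x\<close> is served by one.\<close>
  let ?X = "\<lambda>l. {x. cylinder l \<noteq> {} \<and> (\<exists>\<theta>. thin \<theta> \<and> (\<forall>y\<in>cylinder l. \<phi> (- c y + c x) w = \<theta>))}"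
  have "countable (?X l)" for l
  proof (cases "cylinder l = {}")
    case False
    then obtain y where "y \<in> cylinder l" by blast
    then have "?X l \<subseteq> {x. thin (\<phi> (- c y + c x) w)}" by auto
    then show ?thesis using few by (rule countable_subset)
  qed simp
  then have "countable (\<Union>l. ?X l)" by (intro countable_UN) auto
  moreover have "(\<Union>l. ?X l) = UNIV" using cyl by blast
  ultimately show False using uncountable_UNIV_nat_bool by simp
qed

text \<open>A Cantor set inside \<open>B s\<close> has an uncountable compact image in the orbit of
  that ball. Injectivity needs fibres that are meagre in \<open>G\<close>: a fibre with an interior
  point would give a ball fixing a point, against \<open>not_fixed_by_ball\<close>.\<close>

lemma not_thin: "\<not> thin x"
proof
  assume "thin x"
  then obtain s where s: "s > 0" "\<And>K. compact K \<Longrightarrow> countable ((\<lambda>b. \<phi> b x) ` B s \<inter> K)"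
    unfolding thin_def by blast
  \<comment> \<open>The Cantor set is caught only in a closure; radius \<open>s/2\<close> keeps it
    inside \<open>B s\<close>.\<close>
  have "\<exists>c :: (nat \<Rightarrow> bool) \<Rightarrow> 'g. range c \<subseteq> G.mtopology closure_of (B (s/2)) \<and>
      inj ((\<lambda>g. \<phi> g x) \<circ> c) \<and>
      (\<forall>n \<epsilon> \<epsilon>'. (\<forall>i\<le>n. \<epsilon> i = \<epsilon>' i) \<longrightarrow> dR nm (c \<epsilon>) (c \<epsilon>') \<le> 1 / real (Suc n))"
  proof (rule G.cantor_embedding[OF _ scheme])
    show "d_ideal G.mtopology (meagre_in TG)" by (simp add: TG_eq d_ideal_meagre)
    show "continuous_map G.mtopology euclidean (\<lambda>g. \<phi> g x)"
      using continuous_orbit by (simp add: TG_eq)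
    show "meagre_in TG {a \<in> UNIV. \<phi> a x = p}" for p
    proof -
      let ?F = "{a \<in> topspace TG. \<phi> a x \<in> {p}}"
      have closed: "closedin TG ?F"
        by (rule closedin_continuous_map_preimage[OF continuous_orbit]) simp
      have "TG interior_of ?F = {}"
      proof (rule ccontr)
        assume "TG interior_of ?F \<noteq> {}"
        then obtain t where t: "t \<in> TG interior_of ?F" by blast
        then obtain r where r: "r > 0" "\<And>b. nm b < r \<Longrightarrow> b + t \<in> TG interior_of ?F"
          using openin_interior_of[of TG ?F] unfolding openin_TG by blast
        have *: "\<phi> (b + t) x = p" if "nm b < r" for b
          using r(2)[OF that] interior_of_subset[of TG ?F] by blast
        have "\<phi> b p = p" if "nm b < r" for b using *[OF that] *[of 0] r(1) by (simp add: act_add)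
        then show False by (rule not_fixed_by_ball[OF r(1)])
      qed
      then have "nowhere_dense_in TG ?F"
        using closed by (simp add: nowhere_dense_in_def closure_of_closedin)
      then show ?thesis using nowhere_dense_imp_meagre by fastforce
    qed
    have "0 \<in> B (s/2)" using s(1) by simp
    then show "\<not> meagre_in TG (B (s/2))"
      using baireG openin_B unfolding Baire_space_top_def by blast
  qed simp
  then obtain c :: "(nat \<Rightarrow> bool) \<Rightarrow> 'g" where cl: "range c \<subseteq> G.mtopology closure_of (B (s/2))"
    and inj: "inj (\<lambda>\<epsilon>. \<phi> (c \<epsilon>) x)"
    and c: "\<And>n \<epsilon> \<epsilon>'. (\<forall>i\<le>n. \<epsilon> i = \<epsilon>' i) \<Longrightarrow> dR nm (c \<epsilon>) (c \<epsilon>') \<le> 1 / real (Suc n)"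
    by (auto simp: o_def)
  have "nm (c \<epsilon>) < s" for \<epsilon>
  proof -
    have "c \<epsilon> \<in> G.mtopology closure_of (B (s/2))" using cl by blast
    then obtain b where "b \<in> B (s/2)" "b \<in> G.mball (c \<epsilon>) (s/2)"
      using half_gt_zero[OF s(1)] unfolding G.metric_closure_of by blast
    then have b: "nm b < s/2" "dR nm (c \<epsilon>) b < s/2" by simp_all
    have "nm (c \<epsilon>) \<le> nm (c \<epsilon> - b) + nm b" using nm_add[of "c \<epsilon> - b" b] by simp
    then show ?thesis using b by (simp add: dR_def)
  qed
  then have sub: "range (\<lambda>\<epsilon>. \<phi> (c \<epsilon>) x) \<subseteq> (\<lambda>b. \<phi> b x) ` B s" by auto
  have "compact (range (\<lambda>\<epsilon>. \<phi> (c \<epsilon>) x))"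
    by (rule compact_continuous_image[OF cantor_continuous(1)[OF c] compact_UNIV_nat_bool])
  then have "countable ((\<lambda>b. \<phi> b x) ` B s \<inter> range (\<lambda>\<epsilon>. \<phi> (c \<epsilon>) x))" by (rule s(2))
  then have "countable (range (\<lambda>\<epsilon>. \<phi> (c \<epsilon>) x))" using sub by (simp add: Int_absorb1)
  then show False using inj uncountable_UNIV_nat_bool countable_image_inj_on by blast
qed

section \<open>Orbits of balls are non-meagre and comeagre somewhere\<close>

lemma nonmeagre_ball:
  assumes s: "s > 0"
  shows "\<not> meagre_in euclidean ((\<lambda>b. \<phi> b x) ` B s)"
proof -
  have "\<exists>y. \<forall>s>0. \<not> meagre_in euclidean ((\<lambda>b. \<phi> b y) ` B s)"
  proof (rule ccontr)
    assume "\<not> ?thesis"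
    \<comment> \<open>With these radii \<open>d_ideal_cell\<close> gives a set with non-meagre orbit
      image inside a ball whose orbit image is meagre.\<close>
    then have "\<forall>a. \<exists>r>0. meagre_in euclidean ((\<lambda>b. \<phi> b (\<phi> a x)) ` B r)" by blast
    from choice[OF this] obtain r where
      r: "\<And>a. r a > 0" "\<And>a. meagre_in euclidean ((\<lambda>b. \<phi> b (\<phi> a x)) ` B (r a))" by blast
    let ?small = "\<lambda>E. meagre_in euclidean ((\<lambda>g. \<phi> g x) ` E)"
    have I: "d_ideal G.mtopology ?small" using d_ideal_orbit_meagre by (simp add: TG_eq)
    have "(\<lambda>g. \<phi> g x) ` UNIV = UNIV" using transitiveE by (metis surjI)
    then have "\<not> ?small UNIV" using nonmeagreX by simp
    then have "\<exists>E'\<subseteq>UNIV. \<not> ?small E' \<and> (\<forall>a\<in>E'. \<forall>b\<in>E'. dR nm b a < r a)"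
      by (intro G.d_ideal_cell[OF I]) (use r in auto)
    then obtain E where E: "\<not> ?small E" "\<And>a b. a \<in> E \<Longrightarrow> b \<in> E \<Longrightarrow> dR nm b a < r a" by blast
    have "E \<noteq> {}" using E(1) by (intro notI) (simp add: meagre_in_empty)
    then obtain a where a: "a \<in> E" by blast
    have "E \<subseteq> G.mball a (r a)" using E(2)[OF a] by (auto simp: G.commute[of a])
    then have "(\<lambda>g. \<phi> g x) ` E \<subseteq> (\<lambda>b. \<phi> b (\<phi> a x)) ` B (r a)" using mball_orbit[of x a "r a"] by blast
    then show False using E(1) meagre_in_subset[OF r(2)[of a]] by blast
  qed
  then obtain y where y: "\<And>s. s > 0 \<Longrightarrow> \<not> meagre_in euclidean ((\<lambda>b. \<phi> b y) ` B s)" by blast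
  obtain f where f: "\<phi> f y = x" by (rule transitiveE)
  have "conj_continuous f"
    using openin_topspace[of TG] by (intro conj_continuous_if_not_thin[of UNIV f x]) (simp_all add: not_thin)
  then obtain \<delta> where \<delta>: "\<delta> > 0"
      "\<And>b. nm b < \<delta> \<Longrightarrow> \<exists>a. nm a < s \<and> (\<forall>x. \<phi> (f + b) x = \<phi> (a + f) x)"
    using s unfolding conj_continuous_def by blast
  have "\<phi> f ` (\<lambda>b. \<phi> b y) ` B \<delta> \<subseteq> (\<lambda>b. \<phi> b x) ` B s"
  proof
    fix v assume "v \<in> \<phi> f ` (\<lambda>b. \<phi> b y) ` B \<delta>"
    then obtain b where b: "nm b < \<delta>" "v = \<phi> (f + b) y" by (auto simp: act_add)
    then obtain a where "nm a < s" "v = \<phi> (a + f) y" using \<delta>(2) by metis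
    then show "v \<in> (\<lambda>b. \<phi> b x) ` B s" using f by (auto simp: act_add)
  qed
  moreover have "\<not> meagre_in euclidean (\<phi> f ` (\<lambda>b. \<phi> b y) ` B \<delta>)"
    using y[OF \<delta>(1)] by (simp add: meagre_act_iff)
  ultimately show ?thesis using meagre_in_subset by blast
qed

text \<open>In \<open>comeagre_limits\<close> the group elements converge together with their orbit
  points. As the evaluation is continuous, the limit point is \<open>\<phi> l x\<close>, and
  starting from radius \<open>s/2\<close> keeps \<open>nm l\<close> below \<open>s\<close>.\<close>

lemma comeagre_ball:
  assumes s: "s > 0"
  shows "\<exists>U. open U \<and> U \<noteq> {} \<and> meagre_in euclidean (U - (\<lambda>b. \<phi> b x) ` B s)"
proof -
  let ?good = "{t. \<exists>e l. (\<forall>n. e n \<in> B (s/2)) \<and> limitin G.mtopology e l sequentially \<and>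
      limitin Met_TC.mtopology (\<lambda>n. \<phi> (e n) x) t sequentially}"
  have "\<exists>U. openin Met_TC.mtopology U \<and> U \<noteq> {} \<and> meagre_in Met_TC.mtopology (U - ?good)"
  proof (rule G.comeagre_limits[OF Met_TC.Metric_space_axioms scheme])
    show "\<not> meagre_in Met_TC.mtopology ((\<lambda>g. \<phi> g x) ` B (s/2))"
      using nonmeagre_ball[of "s/2" x] s by simp
    show "meagre_in Met_TC.mtopology ((\<lambda>g. \<phi> g x) ` \<Union>\<E>)"
      if "discrete_family G.mtopology \<E>"
        "\<And>E. E \<in> \<E> \<Longrightarrow> E \<subseteq> B (s/2) \<and> meagre_in Met_TC.mtopology ((\<lambda>g. \<phi> g x) ` E)" for \<E>
      using d_ideal_Union[OF d_ideal_orbit_meagre, of \<E> x] that by (simp add: TG_eq)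
  qed simp_all
  then obtain U where U: "open U" "U \<noteq> {}" "meagre_in euclidean (U - ?good)" by auto
  have "?good \<subseteq> (\<lambda>b. \<phi> b x) ` B s"
  proof
    fix t assume "t \<in> ?good"
    then obtain e l where e: "\<And>n. nm (e n) < s/2" "limitin TG e l sequentially"
        "(\<lambda>n. \<phi> (e n) x) \<longlonglongrightarrow> t" by (auto simp: TG_eq)
    have "(\<lambda>n. \<phi> (e n) x) \<longlonglongrightarrow> \<phi> l x"
      using continuous_map_limit[OF continuous_orbit e(2)] by (simp add: o_def)
    then have "t = \<phi> l x" using e(3) by (metis LIMSEQ_unique)
    moreover have "nm l < s"
    proof -
      obtain n where "dR nm (e n) l < s/2"
        using e(2) half_gt_zero[OF s] unfolding TG_eq G.limitin_metric eventually_sequentially by blast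
      then have "nm (l - e n) < s/2" by (simp add: dR_def nm_commute)
      then show ?thesis using nm_add[of "l - e n" "e n"] e(1)[of n] by simp
    qed
    ultimately show "t \<in> (\<lambda>b. \<phi> b x) ` B s" by auto
  qed
  then have "meagre_in euclidean (U - (\<lambda>b. \<phi> b x) ` B s)"
    by (intro meagre_in_subset[OF U(3)]) blast
  then show ?thesis using U(1,2) by blast
qed

end

theorem theoremE:
  fixes nm :: "'g::group_add \<Rightarrow> real"
    and \<phi> :: "'g \<Rightarrow> 'x::metric_space \<Rightarrow> 'x"
  assumes norm: "group_norm nm"
    and act: "group_action \<phi>"
    and sep: "separately_continuous (norm_topology nm) \<phi>"
    and trans: "transitive_action \<phi>"
    and baireG: "Baire_space_top (norm_topology nm)"
    and nonmeagreX: "\<not> meagre_in euclidean (UNIV :: 'x set)"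
    and hyp: "nikodym_action (norm_topology nm) \<phi> \<or>
              (analytic_via TYPE('c) (UNIV :: 'g set) (dR nm) \<and>
               (\<forall>x. base_sigma_discrete (norm_topology nm) euclidean (\<lambda>g. \<phi> g x)))"
  shows "(\<forall>U x. openin (norm_topology nm) U \<and> 0 \<in> U \<longrightarrow> x \<in> interior ((\<lambda>u. \<phi> u x) ` U))
         \<and> (\<forall>x W. openin (norm_topology nm) W \<longrightarrow> open ((\<lambda>g. \<phi> g x) ` W))
         \<and> micro_transitive (norm_topology nm) \<phi>"
proof -
  interpret normed_action nm \<phi>
    by unfold_locales (fact norm act sep)+
  have ball: "x \<in> interior ((\<lambda>b. \<phi> b x) ` B r)" if r: "r > 0" for x r
  proof (cases "nikodym_action TG \<phi>")
    case True
    show ?thesis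
      by (rule micro_transitive_if_comeagre[OF _ _ r]) (rule comeagre_if_nikodym[OF True]; assumption)+
  next
    case False
    then have an: "analytic_via TYPE('c) (UNIV :: 'g set) (dR nm)"
      and bsd: "\<And>x. base_sigma_discrete TG euclidean (\<lambda>g. \<phi> g x)" using hyp by auto
    show ?thesis
    proof (cases "\<exists>y :: 'x. open {y}")
      case True
      \<comment> \<open>One isolated point makes every point isolated, since the group acts
        transitively by homeomorphisms. Hence \<open>perfect\<close> may be assumed in the other
        case.\<close>
      then obtain y :: 'x where y: "open {y}" by blast
      obtain g where "\<phi> g y = x" using trans by (auto simp: transitive_action_def)
      then have "open {x}" using open_act[OF y, of g] by simp
      moreover have "x \<in> (\<lambda>b. \<phi> b x) ` B r" using r by (intro image_eqI[of _ _ 0]) simp_all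
      ultimately show ?thesis by (intro interiorI[of "{x}"]) simp_all
    next
      case False
      obtain A where "G.analytic_scheme A"
        using analytic_via_scheme[OF G.Metric_space_axioms an] by blast
      then interpret analytic_action nm \<phi> A
        using False by unfold_locales (simp_all add: bsd trans baireG nonmeagreX)
      show ?thesis by (rule micro_transitive_if_comeagre[OF nonmeagre_ball comeagre_ball r])
    qed
  qed
  have nbhd: "x \<in> interior ((\<lambda>u. \<phi> u x) ` U)" if U: "openin TG U" "0 \<in> U" for U x
  proof -
    obtain r where r: "r > 0" "\<And>b. nm b < r \<Longrightarrow> b + 0 \<in> U" using U unfolding openin_TG by blast
    have "(\<lambda>b. \<phi> b x) ` B r \<subseteq> (\<lambda>u. \<phi> u x) ` U" using r(2) by auto
    then show ?thesis using ball[OF r(1)] interior_mono by blast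
  qed
  have "open ((\<lambda>g. \<phi> g x) ` W)" if W: "openin TG W" for x W
    unfolding open_subopen[of "(\<lambda>g. \<phi> g x) ` W"]
  proof
    fix y assume "y \<in> (\<lambda>g. \<phi> g x) ` W"
    then obtain t where t: "t \<in> W" "y = \<phi> t x" by blast
    obtain r where r: "r > 0" "\<And>b. nm b < r \<Longrightarrow> b + t \<in> W" using W t(1) unfolding openin_TG by blast
    have "(\<lambda>b. \<phi> b y) ` B r \<subseteq> (\<lambda>g. \<phi> g x) ` W"
      unfolding t(2) by (auto simp: act_add[symmetric] intro!: imageI r(2))
    then show "\<exists>T. open T \<and> y \<in> T \<and> T \<subseteq> (\<lambda>g. \<phi> g x) ` W"
      using ball[OF r(1), of y] interior_subset open_interior by (meson order_trans)
  qed
  moreover have "micro_transitive TG \<phi>"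
    unfolding micro_transitive_def using nbhd interior_mono image_mono by (metis subsetD)
  ultimately show ?thesis using nbhd by blast
qed

end
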